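(* Let $F$ be a finitely generated free group which is not cyclic, and let $\hat F_{\mathbb Q}$ be its $\mathbb Q$-completion. Then the rational homology group $H_2(\hat F_{\mathbb Q},\mathbb Q)$ is uncountable.
   Context: For a group $G$, let $\gamma_1(G)=G$, $\gamma_{i+1}(G)=[\gamma_i(G),G]$ be the lower central series. The $\mathbb Q$-completion of $G$ is $\hat G_{\mathbb Q}=\varprojlim_i \big(G/\gamma_i(G)\otimes\mathbb Q\big)$, where $N\otimes\mathbb Q$ denotes the Malcev $\mathbb Q$-localization (rationalization) of a nilpotent group $N$. Homology is ordinary group homology of $\hat G_{\mathbb Q}$ regarded as a discrete group. *)

theory Defs
  imports "HOL-Algebra.Algebra" "HOL-Library.Countable_Set"
begin

definition eval_word :: "('a,'m) monoid_scheme \<Rightarrow> (bool \<times> 'a) list \<Rightarrow> 'a" where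
  "eval_word G w = foldr (\<lambda>(b,s) acc. (if b then s else inv\<^bsub>G\<^esub> s) \<otimes>\<^bsub>G\<^esub> acc) w \<one>\<^bsub>G\<^esub>"

definition reduced_word :: "(bool \<times> 'a) list \<Rightarrow> bool" where
  "reduced_word w \<longleftrightarrow> (\<forall>i. Suc i < length w \<longrightarrow>
      \<not> (snd (w ! i) = snd (w ! Suc i) \<and> fst (w ! i) \<noteq> fst (w ! Suc i)))"

definition free_basis :: "('a,'m) monoid_scheme \<Rightarrow> 'a set \<Rightarrow> bool" where
  "free_basis G S \<longleftrightarrow> S \<subseteq> carrier G \<and> generate G S = carrier G \<and>
     (\<forall>w. w \<noteq> [] \<and> set (map snd w) \<subseteq> S \<and> reduced_word w \<longrightarrow> eval_word G w \<noteq> \<one>\<^bsub>G\<^esub>)"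

definition fg_free_group :: "('a,'m) monoid_scheme \<Rightarrow> bool" where
  "fg_free_group G \<longleftrightarrow> group G \<and> (\<exists>S. finite S \<and> free_basis G S)"

text \<open>lcs G i is gamma_(i+1)(G): lcs G 0 = G, lcs G (Suc i) = [lcs G i, G].\<close>
fun lcs :: "('a,'m) monoid_scheme \<Rightarrow> nat \<Rightarrow> 'a set" where
  "lcs G 0 = carrier G"
| "lcs G (Suc i) = generate G
     {x \<otimes>\<^bsub>G\<^esub> y \<otimes>\<^bsub>G\<^esub> inv\<^bsub>G\<^esub> x \<otimes>\<^bsub>G\<^esub> inv\<^bsub>G\<^esub> y | x y. x \<in> lcs G i \<and> y \<in> carrier G}"

definition nilpotent_group :: "('a,'m) monoid_scheme \<Rightarrow> bool" where
  "nilpotent_group G \<longleftrightarrow> group G \<and> (\<exists>c. lcs G c = {\<one>\<^bsub>G\<^esub>})"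

definition uniquely_divisible :: "('a,'m) monoid_scheme \<Rightarrow> bool" where
  "uniquely_divisible G \<longleftrightarrow>
     (\<forall>m \<in> carrier G. \<forall>n::nat. n > 0 \<longrightarrow> (\<exists>!x. x \<in> carrier G \<and> x [^]\<^bsub>G\<^esub> n = m))"

definition rationalization ::
  "('a,'m) monoid_scheme \<Rightarrow> ('b,'n) monoid_scheme \<Rightarrow> ('a \<Rightarrow> 'b) \<Rightarrow> bool" where
  "rationalization N M e \<longleftrightarrow>
     nilpotent_group N \<and> nilpotent_group M \<and> uniquely_divisible M \<and> e \<in> hom N M \<and>
     (\<forall>x \<in> carrier N. e x = \<one>\<^bsub>M\<^esub> \<longrightarrow> (\<exists>n::nat. n > 0 \<and> x [^]\<^bsub>N\<^esub> n = \<one>\<^bsub>N\<^esub>)) \<and>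
     (\<forall>m \<in> carrier M. \<exists>n::nat. n > 0 \<and> m [^]\<^bsub>M\<^esub> n \<in> e ` carrier N)"

definition Q_completion_tower ::
  "('a,'m) monoid_scheme \<Rightarrow> (nat \<Rightarrow> 'b monoid) \<Rightarrow> (nat \<Rightarrow> 'a set \<Rightarrow> 'b)
     \<Rightarrow> (nat \<Rightarrow> 'b \<Rightarrow> 'b) \<Rightarrow> bool" where
  "Q_completion_tower G M e p \<longleftrightarrow>
     (\<forall>i. rationalization (G Mod lcs G i) (M i) (e i)) \<and>
     (\<forall>i. p i \<in> hom (M (Suc i)) (M i)) \<and>
     (\<forall>i. \<forall>x \<in> carrier G. p i (e (Suc i) (lcs G (Suc i) #>\<^bsub>G\<^esub> x)) = e i (lcs G i #>\<^bsub>G\<^esub> x))"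

definition inv_limit :: "(nat \<Rightarrow> 'b monoid) \<Rightarrow> (nat \<Rightarrow> 'b \<Rightarrow> 'b) \<Rightarrow> (nat \<Rightarrow> 'b) monoid" where
  "inv_limit M p =
     \<lparr> carrier = {f. \<forall>i. f i \<in> carrier (M i) \<and> p i (f (Suc i)) = f i},
       monoid.mult = (\<lambda>f g i. f i \<otimes>\<^bsub>M i\<^esub> g i),
       monoid.one = (\<lambda>i. \<one>\<^bsub>M i\<^esub>) \<rparr>"

definition chains :: "'c set \<Rightarrow> ('c \<Rightarrow> rat) set" where
  "chains A = {c. finite {x. c x \<noteq> 0} \<and> {x. c x \<noteq> 0} \<subseteq> A}"

definition ind :: "bool \<Rightarrow> rat" where "ind b = (if b then 1 else 0)"

definition bar_d2 :: "('a,'m) monoid_scheme \<Rightarrow> ('a \<times> 'a \<Rightarrow> rat) \<Rightarrow> ('a \<Rightarrow> rat)" where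
  "bar_d2 G c = (\<lambda>x. \<Sum>q \<in> {q. c q \<noteq> 0}. c q *
      (ind (snd q = x) - ind (fst q \<otimes>\<^bsub>G\<^esub> snd q = x) + ind (fst q = x)))"

definition bar_d3 :: "('a,'m) monoid_scheme \<Rightarrow> ('a \<times> 'a \<times> 'a \<Rightarrow> rat) \<Rightarrow> ('a \<times> 'a \<Rightarrow> rat)" where
  "bar_d3 G c = (\<lambda>y. \<Sum>q \<in> {q. c q \<noteq> 0}. c q *
      (case q of (g, h, k) \<Rightarrow>
         ind ((h, k) = y) - ind ((g \<otimes>\<^bsub>G\<^esub> h, k) = y)
       + ind ((g, h \<otimes>\<^bsub>G\<^esub> k) = y) - ind ((g, h) = y)))"

definition cycles2 :: "('a,'m) monoid_scheme \<Rightarrow> ('a \<times> 'a \<Rightarrow> rat) set" where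
  "cycles2 G = {z \<in> chains (carrier G \<times> carrier G). bar_d2 G z = (\<lambda>_. 0)}"

definition boundaries2 :: "('a,'m) monoid_scheme \<Rightarrow> ('a \<times> 'a \<Rightarrow> rat) set" where
  "boundaries2 G = bar_d3 G ` chains (carrier G \<times> carrier G \<times> carrier G)"

definition H2_rat :: "('a,'m) monoid_scheme \<Rightarrow> ('a \<times> 'a \<Rightarrow> rat) set set" where
  "H2_rat G = cycles2 G // {(a, b). a \<in> cycles2 G \<and> b \<in> cycles2 G \<and> a - b \<in> boundaries2 G}"

end

theory Submission
  imports Defs "HOL-Computational_Algebra.Computational_Algebra"
begin

text \<open>
  Let \<open>D = \<rat>[[x]] \<rtimes> \<rat>\<close>, where \<open>q \<in> \<rat>\<close> acts as multiplication by \<open>e\<^bsup>qx\<^esup>\<close>. The truncations of \<open>D\<close> modulo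
  \<open>x\<^sup>i\<close> are nilpotent and uniquely divisible, so the map \<open>a \<mapsto> (1,0)\<close>, \<open>b \<mapsto> (0,1)\<close> on two basis elements of
  \<open>F\<close> extends to a homomorphism \<open>\<Phi>\<close> from the \<open>\<rat>\<close>-completion of \<open>F\<close> to \<open>D\<close>. Let \<open>k \<subseteq> \<rat>((x))\<close> be the countable
  subfield generated by the \<open>e\<^bsup>qx\<^esup>\<close> and \<open>\<pi>\<close> a \<open>k\<close>-linear projection of \<open>\<rat>((x))\<close> with kernel \<open>k\<close>. The form
  \<open>f(x) \<pi>(g(-x))\<close> is invariant under the action of \<open>\<rat>\<close>, hence yields a 2-cocycle on \<open>D\<close>.

  For \<open>y = (1 - e\<^sup>x)(1 - e\<^bsup>-x\<^esup>)\<close> and \<open>h = \<Sum> h\<^sub>n y\<^sup>n\<close> there is an element \<open>H\<close> of the completion over \<open>(h,0)\<close>.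
  Since \<open>h\<close> is even, \<open>[a,H]\<close> can be shown, by successive approximation along the lower central series, to be of
  the form \<open>[k\<^sub>1,a][k\<^sub>2,b]\<close> with \<open>k\<^sub>1, k\<^sub>2\<close> in the kernel of \<open>\<Phi>\<close>. The 2-cycle given by this relation is mapped to
  \<open>\<pi>(h)\<close> by the cocycle. As \<open>\<pi>\<close> has countable kernel and there are uncountably many \<open>h\<close>, the values are uncountable.
\<close>

section \<open>Commutators and the lower central series\<close>

definition cmt :: "('a,'m) monoid_scheme \<Rightarrow> 'a \<Rightarrow> 'a \<Rightarrow> 'a" where
  "cmt G x y = x \<otimes>\<^bsub>G\<^esub> y \<otimes>\<^bsub>G\<^esub> inv\<^bsub>G\<^esub> x \<otimes>\<^bsub>G\<^esub> inv\<^bsub>G\<^esub> y"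

definition cmt_subgroup :: "('a,'m) monoid_scheme \<Rightarrow> 'a set \<Rightarrow> 'a set" where
  "cmt_subgroup G N = generate G {cmt G x y | x y. x \<in> N \<and> y \<in> carrier G}"

lemma lcs_Suc_eq: "lcs G (Suc i) = cmt_subgroup G (lcs G i)"
  by (simp add: cmt_subgroup_def cmt_def)

declare lcs.simps(2) [simp del] mult_FactGroup [simp del] one_FactGroup [simp del]

definition central_elt :: "('a,'m) monoid_scheme \<Rightarrow> 'a \<Rightarrow> bool" where
  "central_elt G c \<longleftrightarrow> c \<in> carrier G \<and> (\<forall>g\<in>carrier G. c \<otimes>\<^bsub>G\<^esub> g = g \<otimes>\<^bsub>G\<^esub> c)"

context group
begin

text \<open>With \<open>group_word\<close> these rules bring a word into right-associated, freely
  reduced form, so identities that hold in every group follow by simplification.\<close>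

lemma inv_cancel_left [simp]:
  "x \<in> carrier G \<Longrightarrow> y \<in> carrier G \<Longrightarrow> inv x \<otimes> (x \<otimes> y) = y"
  "x \<in> carrier G \<Longrightarrow> y \<in> carrier G \<Longrightarrow> x \<otimes> (inv x \<otimes> y) = y"
  by (simp_all flip: m_assoc)

lemmas group_word = m_assoc inv_mult_group

lemma cmt_closed [simp, intro]: "x \<in> carrier G \<Longrightarrow> y \<in> carrier G \<Longrightarrow> cmt G x y \<in> carrier G"
  by (simp add: cmt_def)

lemma cmt_one [simp]: "x \<in> carrier G \<Longrightarrow> cmt G x \<one> = \<one>" "x \<in> carrier G \<Longrightarrow> cmt G \<one> x = \<one>"
  and cmt_self [simp]: "x \<in> carrier G \<Longrightarrow> cmt G x x = \<one>"
  by (simp_all add: cmt_def group_word)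

lemma cmt_mult: "x \<in> carrier G \<Longrightarrow> y \<in> carrier G \<Longrightarrow> x \<otimes> y = cmt G x y \<otimes> (y \<otimes> x)"
  by (simp add: cmt_def group_word)

lemma inv_cmt: "x \<in> carrier G \<Longrightarrow> y \<in> carrier G \<Longrightarrow> inv (cmt G x y) = cmt G y x"
  by (simp add: cmt_def group_word)

lemma conj_cmt:
  "g \<in> carrier G \<Longrightarrow> x \<in> carrier G \<Longrightarrow> y \<in> carrier G \<Longrightarrow>
   g \<otimes> cmt G x y \<otimes> inv g = cmt G (g \<otimes> x \<otimes> inv g) (g \<otimes> y \<otimes> inv g)"
  by (simp add: cmt_def group_word)

lemma cmt_mult_left:
  "x \<in> carrier G \<Longrightarrow> x' \<in> carrier G \<Longrightarrow> y \<in> carrier G \<Longrightarrow>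
   cmt G (x \<otimes> x') y = x \<otimes> cmt G x' y \<otimes> inv x \<otimes> cmt G x y"
  by (simp add: cmt_def group_word)

lemma cmt_mult_right:
  "x \<in> carrier G \<Longrightarrow> y \<in> carrier G \<Longrightarrow> y' \<in> carrier G \<Longrightarrow>
   cmt G x (y \<otimes> y') = cmt G x y \<otimes> (y \<otimes> cmt G x y' \<otimes> inv y)"
  by (simp add: cmt_def group_word)

lemma central_eltD:
  "central_elt G c \<Longrightarrow> c \<in> carrier G"
  "central_elt G c \<Longrightarrow> g \<in> carrier G \<Longrightarrow> g \<otimes> c = c \<otimes> g"
  "central_elt G c \<Longrightarrow> g \<in> carrier G \<Longrightarrow> g \<otimes> c \<otimes> inv g = c"
proof -
  show "g \<otimes> c \<otimes> inv g = c" if "central_elt G c" "g \<in> carrier G"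
  proof -
    have "g \<otimes> c = c \<otimes> g" "c \<in> carrier G" using that by (simp_all add: central_elt_def)
    then show ?thesis using that(2) by (simp add: m_assoc)
  qed
qed (simp_all add: central_elt_def)

lemma central_elt_cmt: "c \<in> carrier G \<Longrightarrow> (\<And>g. g \<in> carrier G \<Longrightarrow> cmt G c g = \<one>) \<Longrightarrow> central_elt G c"
  unfolding central_elt_def by (metis cmt_mult l_one m_closed)

text \<open>In the product formula only the commutator with \<open>x'\<close> gets conjugated, so
  its centrality alone makes the commutator multiplicative. The same happens in the second argument;
  inverses, quotients and powers follow from this.\<close>

lemma cmt_left_central:
  assumes "x \<in> carrier G" "x' \<in> carrier G" "y \<in> carrier G" "central_elt G (cmt G x' y)"
  shows "cmt G (x \<otimes> x') y = cmt G x y \<otimes> cmt G x' y"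
  using assms central_eltD(2)[OF assms(4), of "cmt G x y"] by (simp add: cmt_mult_left central_eltD(3))

lemma cmt_right_central:
  assumes "x \<in> carrier G" "y \<in> carrier G" "y' \<in> carrier G" "central_elt G (cmt G x y')"
  shows "cmt G x (y \<otimes> y') = cmt G x y \<otimes> cmt G x y'"
  using assms by (simp add: cmt_mult_right central_eltD(3))

lemma cmt_right_inv_central:
  assumes "x \<in> carrier G" "y \<in> carrier G" "central_elt G (cmt G x y)"
  shows "cmt G x (inv y) = inv (cmt G x y)"
proof -
  have "cmt G x (inv y) \<otimes> cmt G x y = cmt G x (inv y \<otimes> y)"
    using assms by (subst cmt_right_central) auto
  also have "\<dots> = \<one>"
    using assms by simp
  finally show ?thesis
    using assms by (intro inv_equality[symmetric]) simp_all
qed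

lemma cmt_left_inv_central:
  assumes "x \<in> carrier G" "y \<in> carrier G" "central_elt G (cmt G x y)"
  shows "cmt G (inv x) y = inv (cmt G x y)"
proof -
  have "cmt G (inv x) y \<otimes> cmt G x y = cmt G (inv x \<otimes> x) y"
    using assms by (subst cmt_left_central) auto
  also have "\<dots> = \<one>"
    using assms by simp
  finally show ?thesis
    using assms by (intro inv_equality[symmetric]) simp_all
qed

text \<open>Multiplicativity is applied to the factorization of \<open>y\<close> as
  \<open>y \<otimes> inv y'\<close> times \<open>y'\<close>, so centrality is asked only of the
  commutator with \<open>y'\<close> itself.\<close>

lemma cmt_right_div_central:
  assumes "x \<in> carrier G" "y \<in> carrier G" "y' \<in> carrier G" "central_elt G (cmt G x y')"
  shows "cmt G x (y \<otimes> inv y') = cmt G x y \<otimes> inv (cmt G x y')"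
proof -
  have "cmt G x y = cmt G x (y \<otimes> inv y') \<otimes> cmt G x y'"
    using assms cmt_right_central[of x "y \<otimes> inv y'" y'] by (simp add: m_assoc)
  then show ?thesis using assms by (simp add: m_assoc)
qed

lemma cmt_left_div_central:
  assumes "x \<in> carrier G" "x' \<in> carrier G" "y \<in> carrier G" "central_elt G (cmt G x' y)"
  shows "cmt G (x \<otimes> inv x') y = cmt G x y \<otimes> inv (cmt G x' y)"
proof -
  have "cmt G x y = cmt G (x \<otimes> inv x') y \<otimes> cmt G x' y"
    using assms cmt_left_central[of "x \<otimes> inv x'" x' y] by (simp add: m_assoc)
  then show ?thesis using assms by (simp add: m_assoc)
qed

lemma cmt_left_pow_central:
  assumes "x \<in> carrier G" "y \<in> carrier G" "central_elt G (cmt G x y)"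
  shows "cmt G (x [^] (k::nat)) y = cmt G x y [^] k"
  by (induction k) (use assms in \<open>auto simp: cmt_left_central\<close>)

lemma cmt_right_pow_central:
  assumes "x \<in> carrier G" "y \<in> carrier G" "central_elt G (cmt G x y)"
  shows "cmt G x (y [^] (k::nat)) = cmt G x y [^] k"
  by (induction k) (use assms in \<open>auto simp: cmt_right_central\<close>)

lemma cmt_in_cmt_subgroup:
  "x \<in> N \<Longrightarrow> y \<in> carrier G \<Longrightarrow> cmt G x y \<in> cmt_subgroup G N"
  unfolding cmt_subgroup_def by (rule generate.incl) blast

text \<open>A conjugate of [x,y] is the commutator of the conjugates, so normality of
  \<open>N\<close> makes the generating set invariant under conjugation.\<close>

lemma normal_cmt_subgroup:
  assumes "N \<lhd> G" shows "cmt_subgroup G N \<lhd> G"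
  unfolding cmt_subgroup_def
proof (rule normal_generateI)
  have [simp]: "x \<in> N \<Longrightarrow> x \<in> carrier G" for x
    using subgroup.mem_carrier[OF normal_imp_subgroup[OF assms]] .
  show "{cmt G x y |x y. x \<in> N \<and> y \<in> carrier G} \<subseteq> carrier G"
    by auto
  fix h g assume "h \<in> {cmt G x y |x y. x \<in> N \<and> y \<in> carrier G}" and g: "g \<in> carrier G"
  then obtain x y where xy: "h = cmt G x y" "x \<in> N" "y \<in> carrier G" by blast
  then have "g \<otimes> h \<otimes> inv g = cmt G (g \<otimes> x \<otimes> inv g) (g \<otimes> y \<otimes> inv g)"
    using g by (simp add: conj_cmt)
  moreover have "g \<otimes> x \<otimes> inv g \<in> N" "g \<otimes> y \<otimes> inv g \<in> carrier G"
    using normal_invE(2)[OF assms g xy(2)] g xy(3) by simp_all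
  ultimately show "g \<otimes> h \<otimes> inv g \<in> {cmt G x y |x y. x \<in> N \<and> y \<in> carrier G}"
    by blast
qed

lemma cmt_in_normal:
  assumes "N \<lhd> G" "x \<in> N" "y \<in> carrier G"
  shows "cmt G x y \<in> N" "cmt G y x \<in> N"
proof -
  interpret N: normal N G by fact
  have x: "x \<in> carrier G" using assms by auto
  have "cmt G x y = x \<otimes> (y \<otimes> inv x \<otimes> inv y)"
    using x assms by (simp add: cmt_def group_word)
  then show 1: "cmt G x y \<in> N"
    using assms by (simp add: N.inv_op_closed2)
  then show "cmt G y x \<in> N"
    using x assms by (metis N.m_inv_closed inv_cmt)
qed

lemma cmt_subgroup_subset:
  assumes "N \<lhd> G" shows "cmt_subgroup G N \<subseteq> N"
  unfolding cmt_subgroup_def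
  by (rule generate_subgroup_incl) (use assms cmt_in_normal normal_imp_subgroup in auto)

lemma cmt_subgroup_mono: "N \<subseteq> N' \<Longrightarrow> cmt_subgroup G N \<subseteq> cmt_subgroup G N'"
  unfolding cmt_subgroup_def by (rule mono_generate) auto

lemma normal_carrier: "carrier G \<lhd> G"
  by (simp add: normal_inv_iff subgroup_self)

lemma normal_lcs: "lcs G i \<lhd> G"
  by (induction i) (auto simp: normal_carrier lcs_Suc_eq normal_cmt_subgroup)

lemma lcs_Suc_subset: "lcs G (Suc i) \<subseteq> lcs G i"
  by (simp add: cmt_subgroup_subset lcs_Suc_eq normal_lcs)

lemma lcs_decreasing: "i \<le> j \<Longrightarrow> lcs G j \<subseteq> lcs G i"
  by (induction rule: dec_induct) (use lcs_Suc_subset in auto)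

lemma lcs_carrier: "x \<in> lcs G i \<Longrightarrow> x \<in> carrier G"
  using lcs_decreasing[of 0 i] by auto

lemma cmt_in_lcs: "x \<in> lcs G i \<Longrightarrow> y \<in> carrier G \<Longrightarrow> cmt G x y \<in> lcs G (Suc i)"
  by (simp add: cmt_in_cmt_subgroup lcs_Suc_eq)

end

lemma (in group_hom) hom_cmt:
  "x \<in> carrier G \<Longrightarrow> y \<in> carrier G \<Longrightarrow> h (cmt G x y) = cmt H (h x) (h y)"
  by (simp add: cmt_def)

lemma (in normal) group_hom_Mod: "group_hom G (G Mod H) (\<lambda>x. H #> x)"
  by (simp add: factorgroup_is_group group_hom.intro group_hom_axioms.intro is_group r_coset_hom_Mod)

lemma (in normal) rcos_eq_iff:
  "x \<in> carrier G \<Longrightarrow> y \<in> carrier G \<Longrightarrow> H #> x = H #> y \<longleftrightarrow> x \<otimes> inv y \<in> H"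
  using rcos_module[OF is_group, of y x] rcos_self[OF _ is_subgroup, of x]
    repr_independence[OF _ _ is_subgroup, of x y] by auto

lemma (in normal) rcos_eq_self_iff:
  "x \<in> carrier G \<Longrightarrow> H #> x = \<one>\<^bsub>G Mod H\<^esub> \<longleftrightarrow> x \<in> H"
  using rcos_eq_iff[of x \<one>] by (simp add: coset_mult_one subset one_FactGroup)

lemma (in normal) central_elt_Mod:
  assumes "x \<in> carrier G" "\<And>g. g \<in> carrier G \<Longrightarrow> cmt G x g \<in> H"
  shows "central_elt (G Mod H) (H #> x)"
proof -
  interpret \<pi>: group_hom G "G Mod H" "\<lambda>x. H #> x" by (rule group_hom_Mod)
  show ?thesis
  proof (rule \<pi>.H.central_elt_cmt)
    show "H #> x \<in> carrier (G Mod H)" using assms by (rule_tac \<pi>.hom_closed)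
    fix g assume "g \<in> carrier (G Mod H)"
    then obtain y where y: "y \<in> carrier G" "g = H #> y" by (auto simp: carrier_FactGroup)
    then show "cmt (G Mod H) (H #> x) g = \<one>\<^bsub>G Mod H\<^esub>"
      using assms \<pi>.hom_cmt[of x y] rcos_eq_self_iff[of "cmt G x y"] by simp
  qed
qed

section \<open>Isolators in nilpotent groups\<close>

context group
begin

text \<open>The image of \<open>L\<close> in \<open>G / [L,G]\<close> is central, so there \<open>(z w)\<^sup>m = z\<^sup>m w\<^sup>m\<close>.\<close>

lemma isolated_subgroup:
  assumes L: "L \<lhd> G" and H: "subgroup H G"
  defines "N \<equiv> cmt_subgroup G L"
  defines "T \<equiv> {z \<in> L. \<exists>m::nat. m > 0 \<and> (\<exists>h\<in>H \<inter> L. N #> (z [^] m) = N #> h)}"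
  shows "subgroup T G"
    and "\<And>z w. z \<in> L \<Longrightarrow> w \<in> T \<Longrightarrow> N #> z = N #> w \<Longrightarrow> z \<in> T"
    and "H \<inter> L \<subseteq> T"
proof -
  interpret L: normal L G by fact
  interpret H: subgroup H G by fact
  interpret N: normal N G unfolding N_def using L by (rule normal_cmt_subgroup)
  interpret \<pi>: group_hom G "G Mod N" "\<lambda>x. N #> x" by (rule N.group_hom_Mod)
  have NL: "N \<subseteq> L" unfolding N_def using L by (rule cmt_subgroup_subset)
  have central: "central_elt (G Mod N) (N #> z)" if "z \<in> L" for z
    using that by (intro N.central_elt_Mod) (auto simp: N_def cmt_in_cmt_subgroup)
  have pow: "N #> (x [^] (k::nat)) = (N #> x) [^]\<^bsub>G Mod N\<^esub> k" if "x \<in> carrier G" for x k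
    using that by (simp add: N.FactGroup_pow)
  have Hpow: "h [^] (k::nat) \<in> H \<inter> L" if "h \<in> H \<inter> L" for h k
  proof -
    have "h [^] k \<in> H" using that by (induction k) auto
    moreover have "h [^] k \<in> L" using that by (induction k) auto
    ultimately show ?thesis by blast
  qed
  have TI: "z \<in> T" if "z \<in> L" "m > 0" "h \<in> H \<inter> L" "N #> (z [^] m) = N #> h" for z h and m :: nat
    using that unfolding T_def by blast
  show "H \<inter> L \<subseteq> T"
  proof
    fix h assume h: "h \<in> H \<inter> L"
    then have "N #> (h [^] (1::nat)) = N #> h" by simp
    with h show "h \<in> T" by (intro TI[of h 1 h]) auto
  qed
  show "z \<in> T" if "z \<in> L" "w \<in> T" "N #> z = N #> w" for z w
  proof -
    obtain m h where mh: "m > (0::nat)" "h \<in> H \<inter> L" "N #> (w [^] m) = N #> h" "w \<in> L"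
      using \<open>w \<in> T\<close> by (auto simp: T_def)
    then have "N #> (z [^] m) = N #> h"
      using that by (simp add: pow)
    then show ?thesis using mh that by (intro TI[of z m h]) auto
  qed
  show "subgroup T G"
  proof
    show "T \<subseteq> carrier G" by (auto simp: T_def)
    show "\<one> \<in> T" by (rule TI[of _ 1 \<one>]) auto
  next
    fix x assume "x \<in> T"
    then obtain m h where mh: "m > (0::nat)" "h \<in> H \<inter> L" "N #> (x [^] m) = N #> h" "x \<in> L"
      by (auto simp: T_def)
    then have "N #> ((inv x) [^] m) = N #> (inv h)"
      by (simp add: nat_pow_inv)
    then show "inv x \<in> T"
      using mh by (intro TI[of _ m "inv h"]) auto
  next
    fix x y assume "x \<in> T" "y \<in> T"
    then obtain m h n h' where mh: "m > (0::nat)" "h \<in> H \<inter> L" "N #> (x [^] m) = N #> h" "x \<in> L"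
      "n > (0::nat)" "h' \<in> H \<inter> L" "N #> (y [^] n) = N #> h'" "y \<in> L"
      by (auto simp: T_def)
    have c: "(N #> x) \<otimes>\<^bsub>G Mod N\<^esub> (N #> y) = (N #> y) \<otimes>\<^bsub>G Mod N\<^esub> (N #> x)"
      using central[OF mh(4)] mh by (auto simp: central_elt_def)
    \<comment> \<open>The exponent \<open>m * n\<close> serves both factors: they commute modulo
      \<open>N\<close>, so the power splits and is congruent to the n-th power of \<open>h\<close>
      times the m-th power of \<open>h'\<close>.\<close>
    have "N #> ((x \<otimes> y) [^] (m * n)) = ((N #> x) \<otimes>\<^bsub>G Mod N\<^esub> (N #> y)) [^]\<^bsub>G Mod N\<^esub> (m * n)"
      using mh L.mem_carrier by (simp only: pow \<pi>.hom_mult m_closed)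
    also have "\<dots> = (N #> x) [^]\<^bsub>G Mod N\<^esub> (m * n) \<otimes>\<^bsub>G Mod N\<^esub> (N #> y) [^]\<^bsub>G Mod N\<^esub> (n * m)"
      using mh L.mem_carrier \<pi>.hom_closed c by (subst \<pi>.H.pow_mult_distrib) (auto simp: mult.commute)
    also have "\<dots> = ((N #> x) [^]\<^bsub>G Mod N\<^esub> m) [^]\<^bsub>G Mod N\<^esub> n \<otimes>\<^bsub>G Mod N\<^esub> ((N #> y) [^]\<^bsub>G Mod N\<^esub> n) [^]\<^bsub>G Mod N\<^esub> m"
      using mh by (simp add: \<pi>.H.nat_pow_pow)
    also have "\<dots> = N #> (h [^] n \<otimes> h' [^] m)"
      using mh by (simp add: pow[symmetric])
    finally have "N #> ((x \<otimes> y) [^] (m * n)) = N #> (h [^] n \<otimes> h' [^] m)" .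
    moreover have "h [^] n \<otimes> h' [^] m \<in> H \<inter> L"
      using Hpow[of h n] Hpow[of h' m] mh by auto
    ultimately show "x \<otimes> y \<in> T"
      using mh by (intro TI[of _ "m * n"]) auto
  qed
qed

text \<open>Each term of the series is generated by commutators [x,y] that are bilinear modulo the
  following term, where [x,y]^(kl) = [x^k,y^l]. If x^k agrees with an element of \<open>H\<close> up
  to a factor from the next term and y^l lies in \<open>H\<close>, this power is congruent to a
  commutator of elements of \<open>H\<close>.\<close>

lemma powers_in_subgroup_mod_lcs:
  assumes A: "A \<subseteq> carrier G" "generate G A = carrier G" and H: "subgroup H G"
    and AH: "\<And>x. x \<in> A \<Longrightarrow> \<exists>k::nat. k > 0 \<and> x [^] k \<in> H"
    and z: "z \<in> lcs G i"
  shows "\<exists>m::nat. m > 0 \<and> (\<exists>h\<in>H \<inter> lcs G i. lcs G (Suc i) #> (z [^] m) = lcs G (Suc i) #> h)"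
  using z
proof (induction i arbitrary: z)
  case 0
  define T where "T = {z \<in> lcs G 0. \<exists>m::nat. m > 0 \<and>
    (\<exists>h\<in>H \<inter> lcs G 0. lcs G (Suc 0) #> (z [^] m) = lcs G (Suc 0) #> h)}"
  have "subgroup T G"
    using isolated_subgroup(1)[OF normal_lcs H, of 0] by (simp add: T_def lcs_Suc_eq)
  moreover have "A \<subseteq> T"
    unfolding T_def using A AH by fastforce
  ultimately have "generate G A \<subseteq> T" by (intro generate_subgroup_incl)
  then show ?case using 0 A by (auto simp: T_def)
next
  case (Suc i)
  interpret H: subgroup H G by fact
  define L where "L = lcs G i"
  define L' where "L' = lcs G (Suc i)"
  define N where "N = lcs G (Suc (Suc i))"
  define T where "T = {z \<in> L'. \<exists>m::nat. m > 0 \<and> (\<exists>h\<in>H \<inter> L'. N #> (z [^] m) = N #> h)}"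
  interpret L: normal L G unfolding L_def by (rule normal_lcs)
  interpret L': normal L' G unfolding L'_def by (rule normal_lcs)
  interpret N: normal N G unfolding N_def by (rule normal_lcs)
  interpret \<pi>: group_hom G "G Mod N" "\<lambda>x. N #> x" by (rule N.group_hom_Mod)
  have N_eq: "N = cmt_subgroup G L'" by (simp add: N_def L'_def lcs_Suc_eq)
  have T: "subgroup T G" "\<And>z w. z \<in> L' \<Longrightarrow> w \<in> T \<Longrightarrow> N #> z = N #> w \<Longrightarrow> z \<in> T" "H \<inter> L' \<subseteq> T"
    using isolated_subgroup[OF L'.normal_axioms H] unfolding T_def N_eq by auto
  interpret T: subgroup T G by fact
  have TI: "z \<in> T" if "z \<in> L'" "m > 0" "h \<in> H \<inter> L'" "N #> (z [^] m) = N #> h" for z h and m :: nat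
    using that unfolding T_def by blast
  have cm: "cmt G x y \<in> L'" if "x \<in> L" "y \<in> carrier G" for x y
    using that by (auto simp: L_def L'_def intro: cmt_in_lcs)
  have central: "central_elt (G Mod N) (N #> z)" if "z \<in> L'" for z
    using that by (intro N.central_elt_Mod) (auto simp: N_eq cmt_in_cmt_subgroup)
  have central': "central_elt (G Mod N) (cmt (G Mod N) (N #> x) (N #> y))" if "x \<in> L" "y \<in> carrier G" for x y
    using that central[OF cm] by (simp add: \<pi>.hom_cmt)
  have pow: "N #> (x [^] (k::nat)) = (N #> x) [^]\<^bsub>G Mod N\<^esub> k" if "x \<in> carrier G" for x k
    using that by (simp add: N.FactGroup_pow)
  \<comment> \<open>First \<open>y\<close> is a generator from \<open>A\<close>, so that y^l lies in
    \<open>H\<close> exactly, whereas x^k does so only up to a factor \<open>u\<close> in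
    \<open>L'\<close>.\<close>
  have TA: "cmt G x y \<in> T" if x: "x \<in> L" and y: "y \<in> A" for x y
  proof -
    obtain l where l: "l > (0::nat)" "y [^] l \<in> H" using AH y by blast
    obtain k h where k: "k > (0::nat)" "h \<in> H" "h \<in> L" "L' #> (x [^] k) = L' #> h"
      using Suc.IH[of x] x by (auto simp: L_def L'_def)
    have yc: "y \<in> carrier G" using y A by auto
    define u where "u = x [^] k \<otimes> inv h"
    have u: "u \<in> L'" using k(4) L'.rcos_eq_iff[of "x [^] k" h] k x by (auto simp: u_def)
    have xk: "x [^] k = u \<otimes> h" using x k by (simp add: u_def m_assoc)
    have "N #> (cmt G x y [^] (k * l)) = cmt (G Mod N) (N #> x) (N #> y) [^]\<^bsub>G Mod N\<^esub> (k * l)"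
      using x yc by (simp add: pow \<pi>.hom_cmt)
    also have "\<dots> = cmt (G Mod N) ((N #> x) [^]\<^bsub>G Mod N\<^esub> k) (N #> y) [^]\<^bsub>G Mod N\<^esub> l"
      using x yc central'[OF x yc] by (simp add: \<pi>.H.cmt_left_pow_central \<pi>.H.nat_pow_pow)
    also have "\<dots> = cmt (G Mod N) (N #> (x [^] k)) (N #> y) [^]\<^bsub>G Mod N\<^esub> l"
      using x by (simp add: pow)
    also have "\<dots> = cmt (G Mod N) (N #> (x [^] k)) ((N #> y) [^]\<^bsub>G Mod N\<^esub> l)"
    proof -
      have "x [^] k \<in> L" using x by (induction k) auto
      from central'[OF this yc] show ?thesis
        using x yc by (subst \<pi>.H.cmt_right_pow_central) auto
    qed
    also have "\<dots> = N #> (cmt G (u \<otimes> h) (y [^] l))"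
      using u k yc by (simp add: pow[symmetric] \<pi>.hom_cmt xk)
    also have "\<dots> = (N #> (u \<otimes> cmt G h (y [^] l) \<otimes> inv u)) \<otimes>\<^bsub>G Mod N\<^esub> (N #> cmt G u (y [^] l))"
      using u k yc by (subst cmt_mult_left) auto
    \<comment> \<open>The error factor disappears: commutators of \<open>u\<close> lie in
      \<open>N\<close>, and conjugation by \<open>u\<close> is trivial on \<open>L'\<close> modulo
      \<open>N\<close>.\<close>
    also have "N #> cmt G u (y [^] l) = \<one>\<^bsub>G Mod N\<^esub>"
      using u yc by (subst N.rcos_eq_self_iff) (auto simp: N_eq cmt_in_cmt_subgroup)
    also have "N #> (u \<otimes> cmt G h (y [^] l) \<otimes> inv u) = N #> cmt G h (y [^] l)"
    proof -
      have hy: "cmt G h (y [^] l) \<in> L'" using k yc by (intro cm) auto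
      have "(N #> u) \<otimes>\<^bsub>G Mod N\<^esub> (N #> cmt G h (y [^] l)) \<otimes>\<^bsub>G Mod N\<^esub> inv\<^bsub>G Mod N\<^esub> (N #> u) = N #> cmt G h (y [^] l)"
        using u hy by (intro \<pi>.H.central_eltD(3) central) auto
      then show ?thesis using u hy L'.mem_carrier
        by (simp only: \<pi>.hom_mult \<pi>.hom_inv m_closed inv_closed)
    qed
    finally have "N #> (cmt G x y [^] (k * l)) = N #> cmt G h (y [^] l)"
      using \<pi>.hom_closed[of "cmt G h (y [^] l)"] k yc by (simp only: \<pi>.H.r_one L.mem_carrier cmt_closed nat_pow_closed)
    moreover have "cmt G h (y [^] l) \<in> H \<inter> L'"
      using k l cm[of h "y [^] l"] yc by (auto simp: cmt_def)
    ultimately show ?thesis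
      using k l cm[OF x yc] by (intro TI[of _ "k * l"]) auto
  qed
  \<comment> \<open>Bilinearity modulo \<open>N\<close> extends the claim from generators to all
    \<open>y\<close>, by induction on words.\<close>
  have "cmt G x y \<in> T" if x: "x \<in> L" and y: "y \<in> carrier G" for x y
  proof -
    have "y \<in> generate G A" using y A by simp
    then show ?thesis
    proof (induction rule: generate.induct)
      case one then show ?case using x by simp
    next
      case (incl y) then show ?case using TA x by simp
    next
      case (inv y)
      then have yc: "y \<in> carrier G" using A by auto
      have "N #> (cmt G x (inv y)) = N #> (inv (cmt G x y))"
        using x yc central'[OF x yc] by (simp add: \<pi>.hom_cmt \<pi>.H.cmt_right_inv_central)
      then show ?case
        using TA[OF x inv] cm[OF x, of "inv y"] yc by (rule_tac T(2)[of _ "inv (cmt G x y)"]) simp_all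
    next
      case (eng y y')
      then have yc: "y \<in> carrier G" "y' \<in> carrier G" using A generate_in_carrier by auto
      have "N #> (cmt G x (y \<otimes> y')) = N #> (cmt G x y \<otimes> cmt G x y')"
        using x yc central'[OF x yc(2)] by (simp add: \<pi>.hom_cmt \<pi>.H.cmt_right_central)
      then show ?case
        using eng cm[OF x, of "y \<otimes> y'"] yc by (rule_tac T(2)[of _ "cmt G x y \<otimes> cmt G x y'"]) simp_all
    qed
  qed
  then have "L' \<subseteq> T"
    unfolding L'_def lcs_Suc_eq cmt_subgroup_def by (intro generate_subgroup_incl T) (auto simp: L_def)
  then show ?case using Suc.prems by (auto simp: T_def L'_def N_def)
qed

text \<open>Successive approximation: let g^k = z h with \<open>h\<close> in \<open>H\<close> and
  \<open>z\<close> in \<open>lcs G i\<close>. Modulo the next term \<open>z\<close> is central and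
  some z^m agrees with an element h' of \<open>H\<close>, so g^(km) agrees with h' h^m. At stage
  \<open>c\<close> the error is trivial.\<close>

lemma nilpotent_powers_in_subgroup:
  assumes A: "A \<subseteq> carrier G" "generate G A = carrier G" and H: "subgroup H G"
    and AH: "\<And>x. x \<in> A \<Longrightarrow> \<exists>k::nat. k > 0 \<and> x [^] k \<in> H"
    and nil: "lcs G c = {\<one>}" and g: "g \<in> carrier G"
  shows "\<exists>k::nat. k > 0 \<and> g [^] k \<in> H"
proof -
  interpret H: subgroup H G by fact
  have "\<exists>k::nat. k > 0 \<and> (\<exists>h\<in>H. g [^] k \<otimes> inv h \<in> lcs G i)" for i
  proof (induction i)
    case 0
    then show ?case using g H.one_closed by (intro exI[of _ 1] conjI bexI[of _ \<one>]) auto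
  next
    case (Suc i)
    define N where "N = lcs G (Suc i)"
    interpret N: normal N G unfolding N_def by (rule normal_lcs)
    interpret \<pi>: group_hom G "G Mod N" "\<lambda>x. N #> x" by (rule N.group_hom_Mod)
    obtain k h where kh: "k > (0::nat)" "h \<in> H" and z: "g [^] k \<otimes> inv h \<in> lcs G i"
      using Suc by blast
    define z where "z = g [^] k \<otimes> inv h"
    have zc: "z \<in> carrier G" using g kh by (simp add: z_def)
    obtain m h' where m: "m > (0::nat)" "h' \<in> H" "N #> (z [^] m) = N #> h'"
      using powers_in_subgroup_mod_lcs[OF A H AH z] unfolding N_def z_def by auto
    have central: "central_elt (G Mod N) (N #> z)"
      using z g kh by (intro N.central_elt_Mod) (auto simp: N_def z_def cmt_in_lcs)
    have gk: "g [^] k = z \<otimes> h" using g kh by (simp add: z_def m_assoc)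
    have "N #> (g [^] (k * m)) = ((N #> z) \<otimes>\<^bsub>G Mod N\<^esub> (N #> h)) [^]\<^bsub>G Mod N\<^esub> m"
      using g kh zc by (simp add: nat_pow_pow[symmetric] gk N.FactGroup_pow[symmetric] \<pi>.hom_mult)
    also have "\<dots> = (N #> z) [^]\<^bsub>G Mod N\<^esub> m \<otimes>\<^bsub>G Mod N\<^esub> (N #> h) [^]\<^bsub>G Mod N\<^esub> m"
      using central kh zc by (intro \<pi>.H.pow_mult_distrib) (auto simp: central_elt_def)
    also have "\<dots> = N #> (h' \<otimes> h [^] m)"
      using kh m zc N.FactGroup_pow[of z m] N.FactGroup_pow[of h m] \<pi>.hom_mult[of h' "h [^] m"] by simp
    finally have "N #> (g [^] (k * m)) = N #> (h' \<otimes> h [^] m)" .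
    then have 1: "g [^] (k * m) \<otimes> inv (h' \<otimes> h [^] m) \<in> N"
      using g kh m by (subst (asm) N.rcos_eq_iff) auto
    have "h [^] m \<in> H" using kh by (induction m) auto
    then have 2: "h' \<otimes> h [^] m \<in> H" using m by auto
    have "k * m > 0" using kh m by simp
    with 1 2 show ?case unfolding N_def by blast
  qed
  then obtain k h where k: "k > (0::nat)" "h \<in> H" "g [^] k \<otimes> inv h \<in> lcs G c" by blast
  then have "g [^] k \<otimes> inv h = \<one>" using nil by simp
  then have "g [^] k = inv (inv h)" using g k by (metis H.mem_carrier inv_closed inv_equality nat_pow_closed)
  then show ?thesis using k by auto
qed

end

lemma lcs_subgroup_subset:
  fixes G (structure)
  assumes "group G" "subgroup K G"
  shows "lcs (G\<lparr>carrier := K\<rparr>) i \<subseteq> lcs G i"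
proof (induction i)
  case 0
  then show ?case using assms by (simp add: subgroup.subset)
next
  case (Suc i)
  interpret group G by fact
  interpret GK: group "G\<lparr>carrier := K\<rparr>" using assms by (simp add: subgroup_imp_group)
  have KG: "K \<subseteq> carrier G" using assms by (simp add: subgroup.subset)
  have inv: "inv\<^bsub>G\<lparr>carrier := K\<rparr>\<^esub> x = inv x" if "x \<in> K" for x
    using assms that by (simp add: m_inv_consistent)
  have "{cmt (G\<lparr>carrier := K\<rparr>) x y |x y. x \<in> lcs (G\<lparr>carrier := K\<rparr>) i \<and> y \<in> carrier (G\<lparr>carrier := K\<rparr>)}
    \<subseteq> {cmt G x y |x y. x \<in> lcs G i \<and> y \<in> carrier G}"
  proof clarify
    fix x y assume x: "x \<in> lcs (G\<lparr>carrier := K\<rparr>) i" and y: "y \<in> carrier (G\<lparr>carrier := K\<rparr>)"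
    have "x \<in> K" using GK.lcs_carrier[OF x] by simp
    then have "cmt (G\<lparr>carrier := K\<rparr>) x y = cmt G x y" using y by (simp add: cmt_def inv)
    then show "\<exists>x' y'. cmt (G\<lparr>carrier := K\<rparr>) x y = cmt G x' y' \<and> x' \<in> lcs G i \<and> y' \<in> carrier G"
      using Suc x y KG by auto
  qed
  moreover have sub: "{cmt (G\<lparr>carrier := K\<rparr>) x y |x y. x \<in> lcs (G\<lparr>carrier := K\<rparr>) i \<and> y \<in> carrier (G\<lparr>carrier := K\<rparr>)} \<subseteq> K"
    using GK.cmt_closed GK.lcs_carrier by auto
  ultimately show ?case
    unfolding lcs_Suc_eq cmt_subgroup_def
    using generate_consistent[OF sub assms(2)] mono_generate by simp
qed

section \<open>Extension to rationalizations and from free bases\<close>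

lemma (in group) lcs_trivial_mono:
  assumes "lcs G c = {\<one>}" "c \<le> d" shows "lcs G d = {\<one>}"
  using lcs_decreasing[OF assms(2)] normal_imp_subgroup[OF normal_lcs[of d]] assms(1) subgroup.one_closed by blast

text \<open>Let \<open>K\<close> be generated by the elements that have a power in \<open>H\<close>.
  The preceding lemma, applied inside \<open>K\<close> with these generators, shows that every
  element of \<open>K\<close> has a power in \<open>H\<close>, so \<open>K\<close> is the set
  itself.\<close>

lemma (in group) isolator_subgroup:
  assumes nil: "lcs G c = {\<one>}" and H: "subgroup H G"
  shows "subgroup {g \<in> carrier G. \<exists>k::nat. k > 0 \<and> g [^] k \<in> H} G" (is "subgroup ?I G")
proof -
  interpret H: subgroup H G by fact
  define K where "K = generate G ?I"
  have I: "?I \<subseteq> carrier G" by blast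
  have K: "subgroup K G" unfolding K_def using I by (rule generate_is_subgroup)
  define GK where "GK = G\<lparr>carrier := K\<rparr>"
  interpret GK: group GK unfolding GK_def using K by (rule subgroup_imp_group)
  have IK: "?I \<subseteq> K" unfolding K_def using generate.incl by (rule subsetI)
  have HI: "H \<subseteq> ?I" by (auto intro!: exI[of _ 1])
  have gen: "generate GK ?I = carrier GK"
    unfolding GK_def using generate_consistent[OF IK K] K_def by simp
  have pw: "x [^]\<^bsub>GK\<^esub> (k::nat) = x [^] k" for x k
    by (simp add: GK_def nat_pow_def)
  have 1: "\<one>\<^bsub>GK\<^esub> = \<one>" by (simp add: GK_def)
  have "lcs GK c \<subseteq> {\<one>}"
    using lcs_subgroup_subset[OF is_group K, of c] nil by (simp add: GK_def)
  then have nilK: "lcs GK c = {\<one>\<^bsub>GK\<^esub>}"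
    using subgroup.one_closed[OF normal_imp_subgroup[OF GK.normal_lcs]] 1 by fastforce
  have HK: "subgroup H GK"
    unfolding GK_def using HI IK subgroup_incl[OF H K] by blast
  have "K \<subseteq> ?I"
  proof
    fix g assume g: "g \<in> K"
    have "\<exists>k::nat. k > 0 \<and> g [^]\<^bsub>GK\<^esub> k \<in> H"
    proof (rule GK.nilpotent_powers_in_subgroup[OF _ gen HK _ nilK])
      show "?I \<subseteq> carrier GK" using IK by (simp add: GK_def)
      show "\<exists>k::nat. k > 0 \<and> x [^]\<^bsub>GK\<^esub> k \<in> H" if "x \<in> ?I" for x
        using that by (simp add: pw)
      show "g \<in> carrier GK" using g by (simp add: GK_def)
    qed
    then show "g \<in> ?I" using g subgroup.mem_carrier[OF K] by (simp add: pw)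
  qed
  then have "?I = K" using IK by blast
  then show ?thesis using K by simp
qed

lemma (in group_hom) hom_lcs: "x \<in> lcs G i \<Longrightarrow> h x \<in> lcs H i"
proof (induction i arbitrary: x)
  case 0 then show ?case by simp
next
  case (Suc i)
  interpret L: subgroup "lcs H (Suc i)" H by (rule normal_imp_subgroup[OF H.normal_lcs])
  from Suc.prems have "x \<in> generate G {cmt G x y |x y. x \<in> lcs G i \<and> y \<in> carrier G}"
    by (simp add: lcs_Suc_eq cmt_subgroup_def)
  then show ?case
  proof (induction rule: generate.induct)
    case (incl z)
    then show ?case using Suc.IH by (auto simp: hom_cmt G.lcs_carrier intro!: H.cmt_in_lcs)
  next
    case (inv z)
    then have "z \<in> carrier G" "h z \<in> lcs H (Suc i)"
      using Suc.IH by (auto simp: hom_cmt G.lcs_carrier intro!: H.cmt_in_lcs)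
    then show ?case by simp
  next
    case (eng z w)
    have "{cmt G x y |x y. x \<in> lcs G i \<and> y \<in> carrier G} \<subseteq> carrier G"
      using G.lcs_carrier by auto
    from G.generate_in_carrier[OF this] show ?case using eng by simp
  qed simp
qed

lemma nat_pow_DirProd: "(x, y) [^]\<^bsub>G \<times>\<times> H\<^esub> (k::nat) = (x [^]\<^bsub>G\<^esub> k, y [^]\<^bsub>H\<^esub> k)"
  by (induction k) auto

text \<open>The extension is constructed as a graph, namely the isolator in the product of
  \<open>M\<close> and \<open>D\<close> of the image of \<open>N\<close> under \<open>e\<close> and
  \<open>\<phi>\<close>. It is total because elements of \<open>M\<close> have powers in the image
  of \<open>e\<close> and \<open>D\<close> has roots. It is single-valued because the kernel of
  \<open>e\<close> is torsion and \<open>D\<close> is torsion-free.\<close>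

lemma rationalization_extend:
  assumes R: "rationalization N M e" and \<phi>: "\<phi> \<in> hom N D"
    and D: "nilpotent_group D" "uniquely_divisible D"
  obtains \<psi> where "\<psi> \<in> hom M D" "\<And>x. x \<in> carrier N \<Longrightarrow> \<psi> (e x) = \<phi> x"
proof -
  from R interpret N: group N by (simp add: rationalization_def nilpotent_group_def)
  from R interpret M: group M by (simp add: rationalization_def nilpotent_group_def)
  from D interpret D: group D by (simp add: nilpotent_group_def)
  from R interpret e: group_hom N M e by unfold_locales (simp add: rationalization_def)
  from \<phi> interpret \<phi>: group_hom N D \<phi> by unfold_locales
  define P where "P = M \<times>\<times> D"
  interpret P: group P unfolding P_def by (rule DirProd_group) (rule M.is_group, rule D.is_group)
  define H where "H = (\<lambda>n. (e n, \<phi> n)) ` carrier N"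
  have "group_hom N P (\<lambda>n. (e n, \<phi> n))"
    by unfold_locales (auto simp: hom_def P_def)
  then have H: "subgroup H P" unfolding H_def by (rule group_hom.img_is_subgroup)
  obtain c where c: "lcs M c = {\<one>\<^bsub>M\<^esub>}" using R by (auto simp: rationalization_def nilpotent_group_def)
  obtain d where d: "lcs D d = {\<one>\<^bsub>D\<^esub>}" using D by (auto simp: nilpotent_group_def)
  have fst: "group_hom P M fst" and snd: "group_hom P D snd"
    by (unfold_locales; auto simp: hom_def P_def)+
  \<comment> \<open>Both projections map the series of the product into trivial groups at this
    index. Nilpotency of the product is what makes the isolator a subgroup.\<close>
  have "lcs P (max c d) \<subseteq> {\<one>\<^bsub>P\<^esub>}"
  proof
    fix x assume x: "x \<in> lcs P (max c d)"
    have "fst x = \<one>\<^bsub>M\<^esub>" using group_hom.hom_lcs[OF fst x] M.lcs_trivial_mono[OF c] by simp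
    moreover have "snd x = \<one>\<^bsub>D\<^esub>" using group_hom.hom_lcs[OF snd x] D.lcs_trivial_mono[OF d] by simp
    ultimately show "x \<in> {\<one>\<^bsub>P\<^esub>}" by (simp add: P_def prod_eq_iff)
  qed
  then have nil: "lcs P (max c d) = {\<one>\<^bsub>P\<^esub>}"
    using subgroup.one_closed[OF normal_imp_subgroup[OF P.normal_lcs]] by fastforce
  define \<Gamma> where "\<Gamma> = {g \<in> carrier P. \<exists>k::nat. k > 0 \<and> g [^]\<^bsub>P\<^esub> k \<in> H}"
  interpret \<Gamma>: subgroup \<Gamma> P
    unfolding \<Gamma>_def by (rule P.isolator_subgroup[OF nil H])
  have ex: "\<exists>d\<in>carrier D. (m, d) \<in> \<Gamma>" if m: "m \<in> carrier M" for m
  proof -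
    obtain k n where k: "k > (0::nat)" "n \<in> carrier N" "m [^]\<^bsub>M\<^esub> k = e n"
      using R m by (auto simp: rationalization_def)
    obtain d where "d \<in> carrier D" "d [^]\<^bsub>D\<^esub> k = \<phi> n"
      using D(2) k \<phi>.hom_closed[of n] unfolding uniquely_divisible_def by blast
    then show ?thesis using k m by (auto simp: \<Gamma>_def P_def nat_pow_DirProd H_def intro!: bexI[of _ d])
  qed
  have D_tors: "y = \<one>\<^bsub>D\<^esub>" if y: "y \<in> carrier D" "k > (0::nat)" "y [^]\<^bsub>D\<^esub> k = \<one>\<^bsub>D\<^esub>" for y k
    using D(2) that D.nat_pow_one[of k] D.one_closed unfolding uniquely_divisible_def by blast
  have one: "y = \<one>\<^bsub>D\<^esub>" if y: "(\<one>\<^bsub>M\<^esub>, y) \<in> \<Gamma>" for y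
  proof -
    obtain k n where k: "k > (0::nat)" "n \<in> carrier N" "\<one>\<^bsub>M\<^esub> = e n" "y [^]\<^bsub>D\<^esub> k = \<phi> n" "y \<in> carrier D"
      using y by (auto simp: \<Gamma>_def P_def nat_pow_DirProd H_def)
    have "e n = \<one>\<^bsub>M\<^esub>" using k(3) by (rule sym)
    with k(2) obtain l where l: "l > (0::nat)" "n [^]\<^bsub>N\<^esub> l = \<one>\<^bsub>N\<^esub>"
      using R by (auto simp: rationalization_def)
    have "y [^]\<^bsub>D\<^esub> (k * l) = \<phi> (n [^]\<^bsub>N\<^esub> l)"
      using k by (simp add: D.nat_pow_pow[symmetric] \<phi>.hom_nat_pow)
    then have "y [^]\<^bsub>D\<^esub> (k * l) = \<one>\<^bsub>D\<^esub>" using l by simp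
    then show ?thesis using D_tors[of y "k * l"] k l by simp
  qed
  have uniq: "y = y'" if "(m, y) \<in> \<Gamma>" "(m, y') \<in> \<Gamma>" for m y y'
  proof -
    have cl: "m \<in> carrier M" "y \<in> carrier D" "y' \<in> carrier D"
      using that \<Gamma>.mem_carrier by (auto simp: P_def)
    have "(m, y) \<otimes>\<^bsub>P\<^esub> inv\<^bsub>P\<^esub> (m, y') \<in> \<Gamma>"
      using that by simp
    moreover have "(m, y) \<otimes>\<^bsub>P\<^esub> inv\<^bsub>P\<^esub> (m, y') = (\<one>\<^bsub>M\<^esub>, y \<otimes>\<^bsub>D\<^esub> inv\<^bsub>D\<^esub> y')"
      using cl by (simp add: P_def inv_DirProd[OF M.is_group D.is_group])
    ultimately have "y \<otimes>\<^bsub>D\<^esub> inv\<^bsub>D\<^esub> y' = \<one>\<^bsub>D\<^esub>" using one by simp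
    then show ?thesis using cl by (metis D.inv_closed D.inv_equality D.inv_inv)
  qed
  define \<psi> where "\<psi> m = (SOME d. (m, d) \<in> \<Gamma>)" for m
  have \<psi>: "(m, \<psi> m) \<in> \<Gamma>" if "m \<in> carrier M" for m
    unfolding \<psi>_def using ex[OF that] by (auto intro: someI)
  have \<psi>_eq: "\<psi> m = d" if "(m, d) \<in> \<Gamma>" for m d
    using that \<psi>[of m] uniq \<Gamma>.mem_carrier[OF that] by (auto simp: P_def)
  have "\<psi> \<in> hom M D"
  proof (rule homI)
    show "\<psi> m \<in> carrier D" if "m \<in> carrier M" for m
      using \<Gamma>.mem_carrier[OF \<psi>[OF that]] by (simp add: P_def)
    show "\<psi> (m \<otimes>\<^bsub>M\<^esub> m') = \<psi> m \<otimes>\<^bsub>D\<^esub> \<psi> m'" if "m \<in> carrier M" "m' \<in> carrier M" for m m'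
      using \<Gamma>.m_closed[OF \<psi>[OF that(1)] \<psi>[OF that(2)]] by (intro \<psi>_eq) (simp add: P_def)
  qed
  moreover have "\<psi> (e x) = \<phi> x" if "x \<in> carrier N" for x
  proof (rule \<psi>_eq)
    have "(e x, \<phi> x) \<in> H" "(e x, \<phi> x) \<in> carrier P" using that by (auto simp: H_def P_def)
    moreover have "(e x, \<phi> x) [^]\<^bsub>P\<^esub> (1::nat) = (e x, \<phi> x)"
      using \<open>(e x, \<phi> x) \<in> carrier P\<close> by (rule P.nat_pow_eone)
    ultimately show "(e x, \<phi> x) \<in> \<Gamma>" unfolding \<Gamma>_def by (metis (mono_tags, lifting) mem_Collect_eq zero_less_one)
  qed
  ultimately show ?thesis using that by blast
qed

text \<open>A power of \<open>m\<close> comes from \<open>N\<close>, where the two maps agree, and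
  roots in \<open>D\<close> are unique.\<close>

lemma rationalization_hom_eq:
  assumes R: "rationalization N M e" and hom: "\<psi> \<in> hom M D" "\<psi>' \<in> hom M D"
    and D: "group D" "uniquely_divisible D"
    and eq: "\<And>x. x \<in> carrier N \<Longrightarrow> \<psi> (e x) = \<psi>' (e x)" and m: "m \<in> carrier M"
  shows "\<psi> m = \<psi>' m"
proof -
  from R interpret M: group M by (simp add: rationalization_def nilpotent_group_def)
  from D interpret D: group D by simp
  from hom interpret \<psi>: group_hom M D \<psi> by unfold_locales
  from hom interpret \<psi>': group_hom M D \<psi>' by unfold_locales
  obtain k n where k: "k > (0::nat)" "n \<in> carrier N" "m [^]\<^bsub>M\<^esub> k = e n"
    using R m by (auto simp: rationalization_def)
  have "\<psi> m [^]\<^bsub>D\<^esub> k = \<psi>' m [^]\<^bsub>D\<^esub> k"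
    using eq[OF k(2)] k m by (simp add: \<psi>.hom_nat_pow[symmetric] \<psi>'.hom_nat_pow[symmetric])
  then show ?thesis
    using D(2) k m \<psi>.hom_closed[OF m] \<psi>'.hom_closed[OF m] unfolding uniquely_divisible_def
    by (metis D.nat_pow_closed)
qed

text \<open>Since \<open>lcs D i\<close> is trivial, \<open>\<phi>\<close> kills
  \<open>lcs G i\<close> and factors through the quotient, from where it extends to the
  rationalization.\<close>

lemma Q_completion_tower_extend:
  assumes T: "Q_completion_tower G M e p" and "group G" and \<phi>: "\<phi> \<in> hom G D"
    and D: "nilpotent_group D" "uniquely_divisible D" "lcs D i = {\<one>\<^bsub>D\<^esub>}"
  obtains \<psi> where "\<psi> \<in> hom (M i) D" "\<And>x. x \<in> carrier G \<Longrightarrow> \<psi> (e i (lcs G i #>\<^bsub>G\<^esub> x)) = \<phi> x"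
proof -
  interpret G: group G by fact
  interpret D: group D using D by (simp add: nilpotent_group_def)
  from \<phi> interpret \<phi>: group_hom G D \<phi> by unfold_locales
  interpret L: normal "lcs G i" G by (rule G.normal_lcs)
  have eq: "\<phi> x = \<phi> y" if "x \<in> carrier G" "y \<in> carrier G" "lcs G i #>\<^bsub>G\<^esub> x = lcs G i #>\<^bsub>G\<^esub> y" for x y
  proof -
    have "x \<otimes>\<^bsub>G\<^esub> inv\<^bsub>G\<^esub> y \<in> lcs G i" using that L.rcos_eq_iff by simp
    from \<phi>.hom_lcs[OF this] have "\<phi> x \<otimes>\<^bsub>D\<^esub> inv\<^bsub>D\<^esub> \<phi> y = \<one>\<^bsub>D\<^esub>" using that D by simp
    then show ?thesis using that by (metis D.inv_closed D.inv_equality D.inv_inv \<phi>.hom_closed)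
  qed
  obtain g where g: "g \<in> hom (G Mod lcs G i) D" "\<And>x. x \<in> carrier G \<Longrightarrow> g (lcs G i #>\<^bsub>G\<^esub> x) = \<phi> x"
    using FactGroup_universal[OF \<phi> G.normal_lcs eq] by blast
  have R: "rationalization (G Mod lcs G i) (M i) (e i)" using T by (simp add: Q_completion_tower_def)
  obtain \<psi> where "\<psi> \<in> hom (M i) D" "\<And>x. x \<in> carrier (G Mod lcs G i) \<Longrightarrow> \<psi> (e i x) = g x"
    using rationalization_extend[OF R g(1) D(1,2)] by blast
  then show ?thesis using that g(2) by (auto simp: carrier_FactGroup)
qed

section \<open>Words and the universal property of a free basis\<close>

definition flip_word :: "(bool \<times> 'a) list \<Rightarrow> (bool \<times> 'a) list" where
  "flip_word w = rev (map (apfst Not) w)"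

context group
begin

lemma eval_word_simps [simp]:
  "eval_word G [] = \<one>"
  "eval_word G ((b, s) # w) = (if b then s else inv s) \<otimes> eval_word G w"
  by (simp_all add: eval_word_def)

lemma eval_word_closed [simp]: "snd ` set w \<subseteq> carrier G \<Longrightarrow> eval_word G w \<in> carrier G"
  by (induction w) (auto split: if_splits)

lemma eval_word_append:
  "snd ` set u \<subseteq> carrier G \<Longrightarrow> snd ` set w \<subseteq> carrier G \<Longrightarrow>
   eval_word G (u @ w) = eval_word G u \<otimes> eval_word G w"
  by (induction u) (auto simp: m_assoc)

lemma eval_word_flip:
  "snd ` set w \<subseteq> carrier G \<Longrightarrow> eval_word G (flip_word w) = inv (eval_word G w)"
proof (induction w)
  case (Cons p w)
  have "snd ` set (flip_word w) \<subseteq> carrier G"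
    using Cons by (auto simp: flip_word_def)
  then show ?case
    using Cons by (cases p) (auto simp: flip_word_def eval_word_append inv_mult_group)
qed (simp add: flip_word_def)

lemma generate_eval_word:
  assumes "g \<in> generate G S" "S \<subseteq> carrier G"
  shows "\<exists>w. snd ` set w \<subseteq> S \<and> eval_word G w = g"
  using assms(1)
proof (induction rule: generate.induct)
  case one then show ?case by (intro exI[of _ "[]"]) simp
next
  case (incl h) then show ?case using assms(2) by (intro exI[of _ "[(True, h)]"]) auto
next
  case (inv h) then show ?case using assms(2) by (intro exI[of _ "[(False, h)]"]) auto
next
  case (eng g h)
  then obtain u w where "snd ` set u \<subseteq> S" "eval_word G u = g" "snd ` set w \<subseteq> S" "eval_word G w = h"
    by blast
  then show ?case using assms(2) by (intro exI[of _ "u @ w"]) (subst eval_word_append, auto)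
qed

end

lemma not_reduced_word_split:
  assumes "\<not> reduced_word w"
  obtains u v b s where "w = u @ (b, s) # (\<not> b, s) # v"
proof -
  obtain i where i: "Suc i < length w" "snd (w ! i) = snd (w ! Suc i)" "fst (w ! i) \<noteq> fst (w ! Suc i)"
    using assms by (auto simp: reduced_word_def)
  have "w = take i w @ w ! i # w ! Suc i # drop (Suc (Suc i)) w"
    using i by (simp add: Cons_nth_drop_Suc)
  moreover have "w ! i = (fst (w ! i), snd (w ! i))" "w ! Suc i = (\<not> fst (w ! i), snd (w ! i))"
    using i by (auto simp: prod_eq_iff)
  ultimately show ?thesis using that by metis
qed

lemma snd_set_map_apsnd: "snd ` set (map (apsnd f) w) = f ` snd ` set w"
  by force

text \<open>A nonempty word with trivial value in \<open>G\<close> cannot be reduced. Deleting a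
  cancelling pair changes the value neither in \<open>G\<close> nor in \<open>D\<close>, and it
  shortens the word.\<close>

lemma free_basis_relation:
  assumes "group G" "group D" and S: "free_basis G S" and f: "f ` S \<subseteq> carrier D"
    and "snd ` set w \<subseteq> S" "eval_word G w = \<one>\<^bsub>G\<^esub>"
  shows "eval_word D (map (apsnd f) w) = \<one>\<^bsub>D\<^esub>"
  using assms(5,6)
proof (induction "length w" arbitrary: w rule: less_induct)
  case less
  interpret G: group G by fact
  interpret D: group D by fact
  have SG: "S \<subseteq> carrier G" using S by (simp add: free_basis_def)
  show ?case
  proof (cases "w = []")
    case False
    then have "\<not> reduced_word w"
      using S less.prems by (auto simp: free_basis_def)
    then obtain u v b s where w: "w = u @ (b, s) # (\<not> b, s) # v"
      by (rule not_reduced_word_split)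
    have cl: "snd ` set u \<subseteq> carrier G" "snd ` set v \<subseteq> carrier G" "s \<in> carrier G" "f s \<in> carrier D"
      "snd ` set (map (apsnd f) u) \<subseteq> carrier D" "snd ` set (map (apsnd f) v) \<subseteq> carrier D"
      using less.prems(1) SG f unfolding w snd_set_map_apsnd by (auto simp: image_subset_iff subset_iff)
    have "eval_word G (u @ v) = eval_word G w"
      using cl unfolding w by (subst (1 2) G.eval_word_append) auto
    then have IH: "eval_word D (map (apsnd f) (u @ v)) = \<one>\<^bsub>D\<^esub>"
      using less.prems by (intro less.hyps) (auto simp: w)
    have "eval_word D (map (apsnd f) (u @ v)) = eval_word D (map (apsnd f) w)"
      using cl unfolding w map_append by (subst (1 2) D.eval_word_append) auto
    then show ?thesis using IH by simp
  qed simp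
qed

text \<open>The map is defined through a chosen word for each element. If \<open>u\<close> and
  \<open>v\<close> have the same value, \<open>v\<close> followed by the formal inverse of
  \<open>u\<close> is a relation, hence trivial in \<open>D\<close>; so the choice does not
  matter.\<close>

lemma free_basis_extend:
  assumes "group G" "group D" and S: "free_basis G S" and f: "f ` S \<subseteq> carrier D"
  obtains \<phi> where "\<phi> \<in> hom G D" "\<And>s. s \<in> S \<Longrightarrow> \<phi> s = f s"
proof -
  interpret G: group G by fact
  interpret D: group D by fact
  have SG: "S \<subseteq> carrier G" "generate G S = carrier G" using S by (simp_all add: free_basis_def)
  define W where "W g = (SOME w. snd ` set w \<subseteq> S \<and> eval_word G w = g)" for g
  have W: "snd ` set (W g) \<subseteq> S" "eval_word G (W g) = g" if "g \<in> carrier G" for g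
    using someI_ex[OF G.generate_eval_word[of g S]] that SG unfolding W_def by auto
  define \<phi> where "\<phi> g = eval_word D (map (apsnd f) (W g))" for g
  have fcl: "snd ` set (map (apsnd f) u) \<subseteq> carrier D" if "snd ` set u \<subseteq> S" for u :: "(bool \<times> 'a) list"
    using that f unfolding snd_set_map_apsnd by auto
  have \<phi>: "\<phi> (eval_word G u) = eval_word D (map (apsnd f) u)" if u: "snd ` set u \<subseteq> S" for u
  proof -
    have ucl: "snd ` set u \<subseteq> carrier G" using u SG by blast
    define v where "v = W (eval_word G u)"
    have v: "snd ` set v \<subseteq> S" "eval_word G v = eval_word G u"
      using W[of "eval_word G u"] ucl by (simp_all add: v_def)
    have vcl: "snd ` set v \<subseteq> carrier G" using v SG by blast
    have fl: "snd ` set (flip_word u) = snd ` set u" by (force simp: flip_word_def)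
    have "eval_word D (map (apsnd f) (v @ flip_word u)) = \<one>\<^bsub>D\<^esub>"
    proof (rule free_basis_relation[OF assms(1,2) S f])
      show "snd ` set (v @ flip_word u) \<subseteq> S" using u v fl by (simp add: image_Un)
      show "eval_word G (v @ flip_word u) = \<one>\<^bsub>G\<^esub>"
        using v ucl vcl fl by (simp add: G.eval_word_append G.eval_word_flip)
    qed
    moreover have "map (apsnd f) (flip_word u) = flip_word (map (apsnd f) u)"
      by (auto simp: flip_word_def rev_map)
    ultimately have "eval_word D (map (apsnd f) v) \<otimes>\<^bsub>D\<^esub> inv\<^bsub>D\<^esub> (eval_word D (map (apsnd f) u)) = \<one>\<^bsub>D\<^esub>"
      using fcl[OF u] fcl[OF v(1)] fcl[of "flip_word u"] u fl
      by (simp only: map_append D.eval_word_append D.eval_word_flip)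
    then show ?thesis
      using fcl[OF u] fcl[OF v(1)] unfolding \<phi>_def v_def[symmetric]
      by (metis D.eval_word_closed D.inv_closed D.inv_equality D.inv_inv)
  qed
  have "\<phi> \<in> hom G D"
  proof (rule homI)
    show "\<phi> g \<in> carrier D" if "g \<in> carrier G" for g
      unfolding \<phi>_def using fcl[OF W(1)[OF that]] by (rule D.eval_word_closed)
    show "\<phi> (g \<otimes>\<^bsub>G\<^esub> h) = \<phi> g \<otimes>\<^bsub>D\<^esub> \<phi> h" if "g \<in> carrier G" "h \<in> carrier G" for g h
    proof -
      have WG: "snd ` set (W g) \<subseteq> carrier G" "snd ` set (W h) \<subseteq> carrier G"
        using W that SG by blast+
      have "\<phi> (eval_word G (W g @ W h)) = eval_word D (map (apsnd f) (W g @ W h))"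
        using W that by (intro \<phi>) auto
      then show ?thesis
        using fcl[OF W(1)[OF that(1)]] fcl[OF W(1)[OF that(2)]] W(2) that WG
        by (simp only: map_append G.eval_word_append D.eval_word_append \<phi>_def)
    qed
  qed
  moreover have "\<phi> s = f s" if "s \<in> S" for s
    using \<phi>[of "[(True, s)]"] that SG f by (auto simp: image_subset_iff subset_iff)
  ultimately show ?thesis using that by blast
qed

section \<open>The group of power series with exponential action\<close>

definition exp_semidirect :: "(rat fps \<times> rat) monoid" where
  "exp_semidirect = \<lparr>carrier = UNIV,
     monoid.mult = (\<lambda>x y. (fst x + fps_exp (snd x) * fst y, snd x + snd y)), one = (0, 0)\<rparr>"

text \<open>The quotient of \<open>exp_semidirect\<close> modulo x^i, with truncated series as
  representatives. All levels thus share one type and \<open>trunc\<close> compares them without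
  cosets.\<close>

definition exp_semidirect_trunc :: "nat \<Rightarrow> (rat fps \<times> rat) monoid" where
  "exp_semidirect_trunc i = \<lparr>carrier = {x. fps_cutoff i (fst x) = fst x},
     monoid.mult = (\<lambda>x y. (fps_cutoff i (fst x + fps_exp (snd x) * fst y), snd x + snd y)), one = (0, 0)\<rparr>"

definition trunc :: "nat \<Rightarrow> rat fps \<times> rat \<Rightarrow> rat fps \<times> rat" where
  "trunc i x = (fps_cutoff i (fst x), snd x)"

lemma fps_cutoff_cutoff_mult:
  fixes f g :: "'a::comm_ring_1 fps"
  shows "fps_cutoff i (fps_cutoff i f * g) = fps_cutoff i (f * g)"
    "fps_cutoff i (g * fps_cutoff i f) = fps_cutoff i (g * f)"
proof -
  show *: "fps_cutoff i (fps_cutoff i f * g) = fps_cutoff i (f * g)" for f g :: "'a fps"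
    by (rule fps_ext) (auto simp: fps_mult_nth intro!: sum.cong)
  then show "fps_cutoff i (g * fps_cutoff i f) = fps_cutoff i (g * f)"
    by (simp add: mult.commute)
qed

lemma fps_cutoff_cutoff: "fps_cutoff i (fps_cutoff j f) = fps_cutoff (min i j) f"
  by (rule fps_ext) auto

lemma exp_semidirect_simps [simp]:
  "carrier exp_semidirect = UNIV"
  "x \<otimes>\<^bsub>exp_semidirect\<^esub> y = (fst x + fps_exp (snd x) * fst y, snd x + snd y)"
  "\<one>\<^bsub>exp_semidirect\<^esub> = (0, 0)"
  by (simp_all add: exp_semidirect_def)

lemma group_exp_semidirect: "group exp_semidirect"
proof (rule groupI)
  fix x :: "rat fps \<times> rat"
  have "(- (fps_exp (- snd x) * fst x), - snd x) \<otimes>\<^bsub>exp_semidirect\<^esub> x = \<one>\<^bsub>exp_semidirect\<^esub>"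
    by simp
  then show "\<exists>y\<in>carrier exp_semidirect. y \<otimes>\<^bsub>exp_semidirect\<^esub> x = \<one>\<^bsub>exp_semidirect\<^esub>"
    by (intro bexI[of _ "(- (fps_exp (- snd x) * fst x), - snd x)"]) simp_all
qed (auto simp: fps_exp_add_mult algebra_simps)

interpretation sd: group exp_semidirect by (rule group_exp_semidirect)

lemma inv_exp_semidirect: "inv\<^bsub>exp_semidirect\<^esub> x = (- (fps_exp (- snd x) * fst x), - snd x)"
  by (rule sd.inv_equality) simp_all

lemma cmt_exp_semidirect:
  "cmt exp_semidirect x y = ((1 - fps_exp (snd y)) * fst x - (1 - fps_exp (snd x)) * fst y, 0)"
proof -
  have "cmt exp_semidirect x y \<otimes>\<^bsub>exp_semidirect\<^esub> (y \<otimes>\<^bsub>exp_semidirect\<^esub> x) = x \<otimes>\<^bsub>exp_semidirect\<^esub> y"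
    using sd.cmt_mult[of x y] by (simp del: exp_semidirect_simps(2))
  then show ?thesis by (auto simp: prod_eq_iff algebra_simps)
qed

lemma group_exp_semidirect_trunc: "group (exp_semidirect_trunc i)"
proof (rule groupI)
  fix x assume "x \<in> carrier (exp_semidirect_trunc i)"
  then show "\<exists>y\<in>carrier (exp_semidirect_trunc i). y \<otimes>\<^bsub>exp_semidirect_trunc i\<^esub> x = \<one>\<^bsub>exp_semidirect_trunc i\<^esub>"
    by (intro bexI[of _ "(- fps_cutoff i (fps_exp (- snd x) * fst x), - snd x)"])
       (auto simp: exp_semidirect_trunc_def fps_cutoff_add fps_cutoff_uminus fps_cutoff_cutoff)
qed (auto simp: exp_semidirect_trunc_def fps_cutoff_add fps_cutoff_cutoff fps_cutoff_cutoff_mult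
    fps_exp_add_mult algebra_simps)

lemma trunc_hom: "group_hom exp_semidirect (exp_semidirect_trunc i) (trunc i)"
  by (rule group_hom.intro[OF group_exp_semidirect group_exp_semidirect_trunc], unfold_locales)
     (auto simp: hom_def exp_semidirect_trunc_def trunc_def fps_cutoff_cutoff fps_cutoff_add fps_cutoff_cutoff_mult)

lemma trunc_hom_trunc:
  assumes "j \<le> i" shows "trunc j \<in> hom (exp_semidirect_trunc i) (exp_semidirect_trunc j)"
  using assms by (auto simp: hom_def exp_semidirect_trunc_def trunc_def fps_cutoff_cutoff fps_cutoff_add fps_cutoff_cutoff_mult)

lemma trunc_id: "x \<in> carrier (exp_semidirect_trunc i) \<Longrightarrow> trunc i x = x"
  by (simp add: exp_semidirect_trunc_def trunc_def)

lemma (in group_hom) lcs_subset_image: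
  assumes "h ` carrier G = carrier H" shows "lcs H i \<subseteq> h ` lcs G i"
proof (induction i)
  case 0 then show ?case using assms by simp
next
  case (Suc i)
  let ?A = "{cmt G x y |x y. x \<in> lcs G i \<and> y \<in> carrier G}"
  have "{cmt H x y |x y. x \<in> lcs H i \<and> y \<in> carrier H} \<subseteq> h ` ?A"
  proof clarify
    fix x y assume "x \<in> lcs H i" "y \<in> carrier H"
    then obtain x' y' where "x' \<in> lcs G i" "y' \<in> carrier G" "x = h x'" "y = h y'"
      using Suc assms by blast
    moreover from this have "cmt H x y = h (cmt G x' y')" "cmt G x' y' \<in> ?A"
      using hom_cmt[of x' y'] G.lcs_carrier by auto
    ultimately show "cmt H x y \<in> h ` ?A" by simp
  qed
  then have "generate H {cmt H x y |x y. x \<in> lcs H i \<and> y \<in> carrier H} \<subseteq> generate H (h ` ?A)"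
    by (rule H.mono_generate)
  moreover have "?A \<subseteq> carrier G" using G.lcs_carrier by auto
  ultimately show ?case
    unfolding lcs_Suc_eq cmt_subgroup_def using generate_img by simp
qed

lemma fps_X_dvd_one_minus_exp: "fps_X dvd (1 - fps_exp (q::rat))"
proof
  show "1 - fps_exp q = fps_X * fps_shift 1 (1 - fps_exp q)"
    by (rule fps_ext) simp
qed

text \<open>Every commutator has second component 0, and the commutator of (f,0) with
  \<open>z\<close> has first component f times 1 - e^(rx), where r is \<open>snd z\<close>; this
  factor is a multiple of x. Counting starts at \<open>Suc i\<close> because the term with index 0
  is the whole group.\<close>

lemma lcs_exp_semidirect: "x \<in> lcs exp_semidirect (Suc i) \<Longrightarrow> fps_X ^ Suc i dvd fst x \<and> snd x = 0"
proof (induction i arbitrary: x)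
  case 0
  then have "x \<in> generate exp_semidirect {cmt exp_semidirect y z |y z. y \<in> UNIV \<and> z \<in> UNIV}"
    by (simp add: lcs_Suc_eq cmt_subgroup_def)
  moreover have "fps_X ^ Suc 0 dvd fst (cmt exp_semidirect y z) \<and> snd (cmt exp_semidirect y z) = 0" for y z
    using dvd_diff[OF dvd_mult2[OF fps_X_dvd_one_minus_exp[of "snd z"], of "fst y"]
        dvd_mult2[OF fps_X_dvd_one_minus_exp[of "snd y"], of "fst z"]]
    by (simp add: cmt_exp_semidirect)
  ultimately show ?case
    by (induction rule: generate.induct) (auto simp: inv_exp_semidirect)
next
  case (Suc i)
  then have "x \<in> generate exp_semidirect {cmt exp_semidirect y z |y z. y \<in> lcs exp_semidirect (Suc i) \<and> z \<in> UNIV}"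
    unfolding lcs_Suc_eq[of _ "Suc i"] by (simp add: cmt_subgroup_def)
  moreover have "fps_X ^ Suc (Suc i) dvd fst (cmt exp_semidirect y z) \<and> snd (cmt exp_semidirect y z) = 0"
    if "y \<in> lcs exp_semidirect (Suc i)" for y z
    using Suc.IH[OF that] mult_dvd_mono[OF fps_X_dvd_one_minus_exp[of "snd z"], of "fps_X ^ Suc i" "fst y"]
    by (simp add: cmt_exp_semidirect)
  ultimately show ?case
    by (induction rule: generate.induct) (auto simp: inv_exp_semidirect)
qed

text \<open>As \<open>trunc i\<close> is surjective, the series comes from that of
  \<open>exp_semidirect\<close>, where the term with index \<open>i\<close> is divisible by x^i. At
  level 0 the group is a copy of the rationals and equals its term with index 0, whence
  \<open>i > 0\<close>.\<close>

lemma lcs_exp_semidirect_trunc: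
  assumes "i > 0" shows "lcs (exp_semidirect_trunc i) i = {\<one>\<^bsub>exp_semidirect_trunc i\<^esub>}"
proof -
  interpret \<tau>: group_hom exp_semidirect "exp_semidirect_trunc i" "trunc i" by (rule trunc_hom)
  have "carrier (exp_semidirect_trunc i) \<subseteq> trunc i ` carrier exp_semidirect"
    using trunc_id by (metis UNIV_I exp_semidirect_simps(1) image_eqI subsetI)
  then have "lcs (exp_semidirect_trunc i) i \<subseteq> trunc i ` lcs exp_semidirect i"
    using \<tau>.hom_closed by (intro \<tau>.lcs_subset_image) blast
  moreover have "trunc i x = (0, 0)" if "x \<in> lcs exp_semidirect i" for x
  proof -
    have "fps_X ^ i dvd fst x \<and> snd x = 0"
      using lcs_exp_semidirect[of x "i - 1"] that assms by simp
    then show ?thesis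
      by (auto simp: trunc_def fps_eq_iff fps_X_power_mult_nth)
  qed
  ultimately have "lcs (exp_semidirect_trunc i) i \<subseteq> {\<one>\<^bsub>exp_semidirect_trunc i\<^esub>}"
    by (auto simp: exp_semidirect_trunc_def)
  then show ?thesis
    using subgroup.one_closed[OF normal_imp_subgroup[OF \<tau>.H.normal_lcs]] by fastforce
qed

lemma nilpotent_exp_semidirect_trunc: "i > 0 \<Longrightarrow> nilpotent_group (exp_semidirect_trunc i)"
  unfolding nilpotent_group_def using lcs_exp_semidirect_trunc group_exp_semidirect_trunc by blast

lemma pow_exp_semidirect:
  "x [^]\<^bsub>exp_semidirect\<^esub> (n::nat) = (fst x * (\<Sum>j<n. fps_exp (of_nat j * snd x)), of_nat n * snd x)"
  by (induction n) (auto simp: algebra_simps)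

text \<open>The n-th power of (f,q) is (f s, nq) with s a sum of \<open>n\<close> exponentials. Its
  constant coefficient is \<open>n\<close>, so s is a unit and both components can be solved for
  uniquely modulo x^i.\<close>

lemma uniquely_divisible_exp_semidirect_trunc: "uniquely_divisible (exp_semidirect_trunc i)"
  unfolding uniquely_divisible_def
proof (intro ballI allI impI)
  fix y and n :: nat
  assume y: "y \<in> carrier (exp_semidirect_trunc i)" and n: "n > 0"
  interpret \<tau>: group_hom exp_semidirect "exp_semidirect_trunc i" "trunc i" by (rule trunc_hom)
  have pow: "x [^]\<^bsub>exp_semidirect_trunc i\<^esub> n = trunc i (x [^]\<^bsub>exp_semidirect\<^esub> n)"
    if "x \<in> carrier (exp_semidirect_trunc i)" for x
    using \<tau>.hom_nat_pow[of x n] trunc_id[OF that] by simp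
  define q where "q = snd y / of_nat n"
  define s where "s = (\<Sum>j<n. fps_exp (of_nat j * q))"
  have "s $ 0 \<noteq> 0" using n by (simp add: s_def fps_sum_nth)
  then have s: "s * inverse s = 1" by (rule inverse_mult_eq_1')
  define x where "x = trunc i (fst y * inverse s, q)"
  have nq: "of_nat n * q = snd y" using n by (simp add: q_def)
  show "\<exists>!x. x \<in> carrier (exp_semidirect_trunc i) \<and> x [^]\<^bsub>exp_semidirect_trunc i\<^esub> n = y"
  proof (intro ex1I[of _ x] conjI)
    show xc: "x \<in> carrier (exp_semidirect_trunc i)" unfolding x_def by (rule \<tau>.hom_closed) simp
    have "fps_cutoff i (fst y * inverse s * s) = fst y"
      using s y by (simp add: mult.assoc mult.commute[of "inverse s"] exp_semidirect_trunc_def)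
    then show "x [^]\<^bsub>exp_semidirect_trunc i\<^esub> n = y"
      by (simp add: pow[OF xc] pow_exp_semidirect)
         (simp add: x_def trunc_def fps_cutoff_cutoff_mult nq prod_eq_iff s_def)
  next
    fix z assume z: "z \<in> carrier (exp_semidirect_trunc i) \<and> z [^]\<^bsub>exp_semidirect_trunc i\<^esub> n = y"
    then have *: "trunc i (z [^]\<^bsub>exp_semidirect\<^esub> n) = y" using pow[of z] by simp
    then have "of_nat n * snd z = snd y" by (auto simp: trunc_def pow_exp_semidirect)
    then have zq: "snd z = q" using n by (simp add: q_def field_simps)
    have "fps_cutoff i (fst z * s) = fst y"
      using * by (auto simp: trunc_def pow_exp_semidirect zq s_def)
    then have "fps_cutoff i (fst y * inverse s) = fps_cutoff i (fst z * s * inverse s)"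
      by (metis fps_cutoff_cutoff_mult(1))
    also have "\<dots> = fst z"
      using s z by (simp add: mult.assoc exp_semidirect_trunc_def)
    finally show "z = x" by (simp add: x_def trunc_def zq prod_eq_iff)
  qed
qed

section \<open>The countable field of exponentials and a linear projection with this kernel\<close>

datatype expo_term = Expo rat | Add expo_term expo_term | Mul expo_term expo_term | Neg expo_term | Recip expo_term

instance expo_term :: countable
  by countable_datatype

primrec eval_expo :: "expo_term \<Rightarrow> rat fls" where
  "eval_expo (Expo q) = fps_to_fls (fps_exp q)"
| "eval_expo (Add s t) = eval_expo s + eval_expo t"
| "eval_expo (Mul s t) = eval_expo s * eval_expo t"
| "eval_expo (Neg s) = - eval_expo s"
| "eval_expo (Recip s) = inverse (eval_expo s)"

text \<open>The subfield generated by the exponentials, given as the values of formal terms: closure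
  under the operations is built in, and countability is inherited from the type of terms.\<close>

definition expo_field :: "rat fls set" where "expo_field = range eval_expo"

lemma countable_expo_field: "countable expo_field"
  by (simp add: expo_field_def)

lemma expo_field_exp: "fps_to_fls (fps_exp q) \<in> expo_field"
  unfolding expo_field_def using eval_expo.simps(1) by (metis rangeI)

lemma expo_field_closed:
  "1 \<in> expo_field"
  "f \<in> expo_field \<Longrightarrow> g \<in> expo_field \<Longrightarrow> f + g \<in> expo_field"
  "f \<in> expo_field \<Longrightarrow> g \<in> expo_field \<Longrightarrow> f * g \<in> expo_field"
  "f \<in> expo_field \<Longrightarrow> - f \<in> expo_field"
  "f \<in> expo_field \<Longrightarrow> inverse f \<in> expo_field"
proof -
  show "1 \<in> expo_field" using expo_field_exp[of 0] by simp
  show "f + g \<in> expo_field" if "f \<in> expo_field" "g \<in> expo_field"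
    using that by (auto simp: expo_field_def image_iff) (rule exI, rule eval_expo.simps(2)[symmetric])
  show "f * g \<in> expo_field" if "f \<in> expo_field" "g \<in> expo_field"
    using that by (auto simp: expo_field_def image_iff) (rule exI, rule eval_expo.simps(3)[symmetric])
  show "- f \<in> expo_field" if "f \<in> expo_field"
    using that by (auto simp: expo_field_def image_iff) (rule exI, rule eval_expo.simps(4)[symmetric])
  show "inverse f \<in> expo_field" if "f \<in> expo_field"
    using that by (auto simp: expo_field_def image_iff) (rule exI, rule eval_expo.simps(5)[symmetric])
qed

text \<open>The map is the projection along \<open>K\<close> onto a \<open>K\<close>-linear complement of \<open>K\<close>, which exists by Zorn's lemma.\<close>

lemma subfield_projection:
  fixes K :: "'a::field set"
  assumes K: "1 \<in> K" "\<And>x y. x \<in> K \<Longrightarrow> y \<in> K \<Longrightarrow> x + y \<in> K" "\<And>x y. x \<in> K \<Longrightarrow> y \<in> K \<Longrightarrow> x * y \<in> K"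
    "\<And>x. x \<in> K \<Longrightarrow> - x \<in> K" "\<And>x. x \<in> K \<Longrightarrow> inverse x \<in> K"
  shows "\<exists>\<pi> :: 'a \<Rightarrow> 'a. (\<forall>x y. \<pi> (x + y) = \<pi> x + \<pi> y) \<and>
    (\<forall>c\<in>K. \<forall>x. \<pi> (c * x) = c * \<pi> x) \<and> (\<forall>x. \<pi> x = 0 \<longleftrightarrow> x \<in> K)"
proof -
  have K0: "0 \<in> K" using K(2)[OF K(1) K(4)[OF K(1)]] by simp
  \<comment> \<open>The \<open>K\<close>-subspaces that meet \<open>K\<close> only in 0; a maximal
    one will be the complement.\<close>
  define \<A> where "\<A> = {C. 0 \<in> C \<and> (\<forall>x\<in>C. \<forall>y\<in>C. x + y \<in> C) \<and> (\<forall>c\<in>K. \<forall>x\<in>C. c * x \<in> C) \<and> C \<inter> K \<subseteq> {0}}"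
  have "\<exists>C\<in>\<A>. \<forall>B\<in>\<A>. C \<subseteq> B \<longrightarrow> B = C"
  proof (rule subset_Zorn_nonempty)
    have "{0} \<in> \<A>" by (auto simp: \<A>_def)
    then show "\<A> \<noteq> {}" by blast
    fix \<C> assume ne: "\<C> \<noteq> {}" and ch: "subset.chain \<A> \<C>"
    have sub: "\<C> \<subseteq> \<A>" using ch by (simp add: subset_chain_def)
    have add: "x + y \<in> \<Union>\<C>" if xy: "x \<in> \<Union>\<C>" "y \<in> \<Union>\<C>" for x y
    proof -
      obtain B1 B2 where B: "B1 \<in> \<C>" "x \<in> B1" "B2 \<in> \<C>" "y \<in> B2" using xy by blast
      have "B1 \<subseteq> B2 \<or> B2 \<subseteq> B1" using ch B by (auto simp: subset_chain_def)
      then obtain B where "B \<in> \<C>" "x \<in> B" "y \<in> B" using B by blast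
      moreover from this have "x + y \<in> B" using sub by (auto simp: \<A>_def)
      ultimately show ?thesis by blast
    qed
    show "\<Union>\<C> \<in> \<A>"
      unfolding \<A>_def
    proof (intro CollectI conjI ballI)
      show "0 \<in> \<Union>\<C>" using ne sub by (auto simp: \<A>_def)
    next
      show "c * x \<in> \<Union>\<C>" if "c \<in> K" "x \<in> \<Union>\<C>" for c x using that sub by (auto simp: \<A>_def)
    next
      show "\<Union>\<C> \<inter> K \<subseteq> {0}" using sub by (auto simp: \<A>_def)
    qed (rule add)
  qed
  then obtain C where C\<A>: "C \<in> \<A>" and max: "\<And>B. B \<in> \<A> \<Longrightarrow> C \<subseteq> B \<Longrightarrow> B = C" by blast
  then have C: "0 \<in> C" "\<And>x y. x \<in> C \<Longrightarrow> y \<in> C \<Longrightarrow> x + y \<in> C" "\<And>c x. c \<in> K \<Longrightarrow> x \<in> C \<Longrightarrow> c * x \<in> C"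
    "\<And>x. x \<in> C \<Longrightarrow> x \<in> K \<Longrightarrow> x = 0"
    unfolding \<A>_def by blast+
  have Cdiff: "x - y \<in> C" if "x \<in> C" "y \<in> C" for x y
    using C(2)[OF that(1) C(3)[OF K(4)[OF K(1)] that(2)]] by simp
  have Kdiff: "x - y \<in> K" if "x \<in> K" "y \<in> K" for x y
    using K(2)[OF that(1) K(4)[OF that(2)]] by simp
  have ex: "\<exists>c\<in>C. f - c \<in> K" for f
  proof (rule ccontr)
    assume no: "\<not> (\<exists>c\<in>C. f - c \<in> K)"
    \<comment> \<open>If \<open>f\<close> were not in \<open>C\<close> + \<open>K\<close>, then
      \<open>C\<close> could be enlarged by \<open>f\<close>: an element c + uf of \<open>K\<close>
      with u nonzero would, after division by u, exhibit \<open>f\<close> as a sum of elements of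
      \<open>C\<close> and \<open>K\<close>.\<close>
    define B where "B = {c + u * f | c u. c \<in> C \<and> u \<in> K}"
    have BI: "c + u * f \<in> B" if "c \<in> C" "u \<in> K" for c u using that unfolding B_def by blast
    have CB: "C \<subseteq> B" using BI[OF _ K0] by auto
    have "B \<in> \<A>"
      unfolding \<A>_def
    proof (intro CollectI conjI ballI subsetI)
      show "0 \<in> B" using CB C by blast
    next
      fix x y assume "x \<in> B" "y \<in> B"
      then obtain c u c' u' where "x = c + u * f" "y = c' + u' * f" "c \<in> C" "c' \<in> C" "u \<in> K" "u' \<in> K"
        by (auto simp: B_def)
      moreover from this have "x + y = (c + c') + (u + u') * f" by (simp add: algebra_simps)
      ultimately show "x + y \<in> B" using C(2) K(2) unfolding B_def by blast
    next
      fix d x assume "d \<in> K" "x \<in> B"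
      then obtain c u where "x = c + u * f" "c \<in> C" "u \<in> K" by (auto simp: B_def)
      moreover from this have "d * x = d * c + (d * u) * f" by (simp add: algebra_simps)
      ultimately show "d * x \<in> B" using C(3) K(3) \<open>d \<in> K\<close> unfolding B_def by blast
    next
      fix x assume "x \<in> B \<inter> K"
      then obtain c u where x: "x = c + u * f" "c \<in> C" "u \<in> K" "x \<in> K" by (auto simp: B_def)
      show "x \<in> {0}"
      proof (cases "u = 0")
        case True
        then show ?thesis using x C by simp
      next
        case False
        have "f - (- inverse u) * c = inverse u * x" using False x by (simp add: field_simps)
        moreover have "inverse u * x \<in> K" by (rule K(3)[OF K(5)[OF x(3)] x(4)])
        moreover have "(- inverse u) * c \<in> C" by (rule C(3)[OF K(4)[OF K(5)[OF x(3)]] x(2)])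
        ultimately have False using no by (metis (no_types))
        then show ?thesis ..
      qed
    qed
    then have "B = C" using max CB by blast
    moreover have "f \<in> B" using BI[OF C(1) K(1)] by simp
    ultimately have "f \<in> C" "f - f \<in> K" using K0 by simp_all
    then show False using no by blast
  qed
  define \<pi> where "\<pi> f = (SOME c. c \<in> C \<and> f - c \<in> K)" for f
  have \<pi>: "\<pi> f \<in> C" "f - \<pi> f \<in> K" for f
    using someI_ex[of "\<lambda>c. c \<in> C \<and> f - c \<in> K"] ex[of f] unfolding \<pi>_def by blast+
  have \<pi>_eq: "\<pi> f = c" if "c \<in> C" "f - c \<in> K" for f c
  proof -
    have "\<pi> f - c \<in> C" using \<pi> that Cdiff by blast
    moreover have "\<pi> f - c \<in> K" using Kdiff[OF that(2) \<pi>(2)[of f]] by simp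
    ultimately show ?thesis using C(4) by fastforce
  qed
  show ?thesis
  proof (intro exI conjI allI ballI)
    show "\<pi> (x + y) = \<pi> x + \<pi> y" for x y
      using K(2)[OF \<pi>(2)[of x] \<pi>(2)[of y]] C(2) \<pi>(1) by (intro \<pi>_eq) (auto simp: algebra_simps)
    show "\<pi> (c * x) = c * \<pi> x" if "c \<in> K" for c x
      using K(3)[OF that \<pi>(2)[of x]] C(3) \<pi>(1) that by (intro \<pi>_eq) (auto simp: algebra_simps)
    show "\<pi> x = 0 \<longleftrightarrow> x \<in> K" for x
      using \<pi>(2)[of x] \<pi>_eq[of 0 x] C(1) by auto
  qed
qed

section \<open>Commutators in two-generated groups\<close>

lemma (in group) normal_Int: "N \<lhd> G \<Longrightarrow> N' \<lhd> G \<Longrightarrow> N \<inter> N' \<lhd> G"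
  using normal_invE subgroups_Inter_pair by (intro normal_invI) auto

text \<open>Modulo [[S,G],G] the subgroup [S,G] is central and [r,g] with r in \<open>S\<close> is
  bilinear. A commutator with a word in \<open>a\<close> and \<open>b\<close> therefore splits into
  commutators with \<open>a\<close> and with \<open>b\<close>, and those of each kind merge into
  one.\<close>

lemma (in group) cmt_subgroup_two_generators:
  assumes ab: "a \<in> carrier G" "b \<in> carrier G" "generate G {a, b} = carrier G" and S: "S \<lhd> G"
    and \<delta>: "\<delta> \<in> cmt_subgroup G S"
  defines "N \<equiv> cmt_subgroup G (cmt_subgroup G S)"
  shows "\<exists>r\<in>S. \<exists>s\<in>S. N #> \<delta> = N #> (cmt G r a \<otimes> cmt G s b)"
proof -
  define C where "C = cmt_subgroup G S"
  interpret S: normal S G by fact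
  interpret C: normal C G unfolding C_def using S by (rule normal_cmt_subgroup)
  interpret N: normal N G unfolding N_def by (intro normal_cmt_subgroup S)
  interpret \<pi>: group_hom G "G Mod N" "\<lambda>x. N #> x" by (rule N.group_hom_Mod)
  have central: "central_elt (G Mod N) (N #> z)" if "z \<in> C" for z
    using that by (intro N.central_elt_Mod) (auto simp: N_def C_def cmt_in_cmt_subgroup)
  have cC: "cmt G r g \<in> C" if "r \<in> S" "g \<in> carrier G" for r g
    using that by (auto simp: C_def cmt_in_cmt_subgroup)
  have central': "central_elt (G Mod N) (cmt (G Mod N) (N #> r) (N #> g))" if "r \<in> S" "g \<in> carrier G" for r g
    using central[OF cC[OF that]] that by (simp add: \<pi>.hom_cmt)
  have comm: "x \<otimes>\<^bsub>G Mod N\<^esub> y = y \<otimes>\<^bsub>G Mod N\<^esub> x"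
    if "central_elt (G Mod N) y" "x \<in> carrier (G Mod N)" for x y
    using that by (simp add: central_elt_def)
  define T where "T = {\<delta> \<in> C. \<exists>r\<in>S. \<exists>s\<in>S. N #> \<delta> = N #> (cmt G r a \<otimes> cmt G s b)}"
  have TI: "\<delta> \<in> T" if "\<delta> \<in> C" "r \<in> S" "s \<in> S" "N #> \<delta> = N #> (cmt G r a \<otimes> cmt G s b)" for \<delta> r s
    using that unfolding T_def by blast
  have T: "subgroup T G"
  proof
    show "T \<subseteq> carrier G" by (auto simp: T_def)
    show "\<one> \<in> T" by (rule TI[of _ \<one> \<one>]) (use ab in auto)
  next
    fix x y assume "x \<in> T" "y \<in> T"
    then obtain r s r' s' where x: "x \<in> C" "r \<in> S" "s \<in> S" "N #> x = N #> (cmt G r a \<otimes> cmt G s b)"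
      and y: "y \<in> C" "r' \<in> S" "s' \<in> S" "N #> y = N #> (cmt G r' a \<otimes> cmt G s' b)" by (auto simp: T_def)
    have "N #> (x \<otimes> y) = N #> (cmt G (r \<otimes> r') a \<otimes> cmt G (s \<otimes> s') b)"
      using x y ab central'[of r' a] central'[of s' b]
        comm[OF central'[of r' a], of "cmt (G Mod N) (N #> s) (N #> b)"]
      by (simp add: \<pi>.hom_cmt \<pi>.H.cmt_left_central \<pi>.H.m_assoc flip: \<pi>.H.m_assoc[of "cmt (G Mod N) (N #> s) (N #> b)"])
    then show "x \<otimes> y \<in> T" using x y by (intro TI[of _ "r \<otimes> r'" "s \<otimes> s'"]) auto
  next
    fix x assume "x \<in> T"
    then obtain r s where x: "x \<in> C" "r \<in> S" "s \<in> S" "N #> x = N #> (cmt G r a \<otimes> cmt G s b)"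
      by (auto simp: T_def)
    have "N #> x = N #> (cmt G s b \<otimes> cmt G r a)"
      using x ab comm[OF central'[of s b], of "cmt (G Mod N) (N #> r) (N #> a)"] by (simp add: \<pi>.hom_cmt)
    then have "N #> inv x = N #> (cmt G (inv r) a \<otimes> cmt G (inv s) b)"
      using x ab central'[of r a] central'[of s b]
      by (simp add: \<pi>.hom_cmt \<pi>.H.cmt_left_inv_central \<pi>.H.inv_mult_group)
    then show "inv x \<in> T" using x by (intro TI[of _ "inv r" "inv s"]) auto
  qed
  interpret T: subgroup T G by fact
  have T_cong: "x \<in> T" if "x \<in> C" "y \<in> T" "N #> x = N #> y" for x y
    using that unfolding T_def by simp
  have "cmt G r g \<in> T" if r: "r \<in> S" and g: "g \<in> carrier G" for r g
  proof -
    have basic: "cmt G r h \<in> T" if "r \<in> S" "h \<in> {a, b}" for r h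
      using that ab TI[of "cmt G r a" r \<one>] TI[of "cmt G r b" \<one> r] cC by auto
    have "g \<in> generate G {a, b}" using g ab by simp
    then show ?thesis
    proof (induction rule: generate.induct)
      case one then show ?case using r by simp
    next
      case (incl h) then show ?case using basic r by simp
    next
      case (inv h)
      then have h: "h \<in> carrier G" using ab by auto
      have "N #> cmt G r (inv h) = N #> cmt G (inv r) h"
        using r h central'[OF r h]
        by (simp add: \<pi>.hom_cmt \<pi>.H.cmt_left_inv_central \<pi>.H.cmt_right_inv_central)
      moreover have "cmt G (inv r) h \<in> T" using basic[of "inv r" h] inv r by simp
      moreover have "cmt G r (inv h) \<in> C" using r h by (intro cC) simp_all
      ultimately show ?case using T_cong by metis
    next
      case (eng h h')
      then have h: "h \<in> carrier G" "h' \<in> carrier G" using ab by simp_all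
      have "N #> cmt G r (h \<otimes> h') = N #> (cmt G r h \<otimes> cmt G r h')"
        using r h central'[OF r h(2)] by (simp add: \<pi>.hom_cmt \<pi>.H.cmt_right_central)
      moreover have "cmt G r h \<otimes> cmt G r h' \<in> T" using eng by simp
      moreover have "cmt G r (h \<otimes> h') \<in> C" using r h by (intro cC) simp_all
      ultimately show ?case using T_cong by metis
    qed
  qed
  then have "C \<subseteq> T"
    unfolding C_def cmt_subgroup_def by (intro generate_subgroup_incl T) auto
  then have "\<delta> \<in> T" using \<delta> by (auto simp: C_def)
  then show ?thesis unfolding T_def by blast
qed

text \<open>In the application \<open>G\<close> is generated by two elements of the free basis,
  \<open>A\<close> is the preimage of the power series part and \<open>R\<close> is the kernel of
  the map to \<open>exp_semidirect\<close>. Commutators of \<open>A\<close> lie in \<open>R\<close>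
  because the power series part is abelian.\<close>

locale two_generated_group = group +
  fixes a b :: 'a and A R :: "'a set"
  assumes generators: "a \<in> carrier G" "b \<in> carrier G" "generate G {a, b} = carrier G"
    and A: "A \<lhd> G" "a \<in> A" and R: "R \<lhd> G" "\<And>x y. x \<in> A \<Longrightarrow> y \<in> A \<Longrightarrow> cmt G x y \<in> R"
begin

text \<open>Approximation is measured by congruence modulo \<open>N n\<close> rather than modulo
  \<open>lcs G n\<close>, because the correction terms have to stay inside \<open>R\<close>.\<close>

definition S :: "nat \<Rightarrow> 'a set" where "S n = R \<inter> lcs G n"
definition N :: "nat \<Rightarrow> 'a set" where "N n = cmt_subgroup G (S n)"

lemma normal_S: "S n \<lhd> G"
  unfolding S_def using R(1) normal_lcs by (rule normal_Int)

lemma normal_N: "N n \<lhd> G"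
  unfolding N_def using normal_S by (rule normal_cmt_subgroup)

lemma N_subset: "N n \<subseteq> S (Suc n)"
proof -
  have "N n \<subseteq> S n" unfolding N_def by (rule cmt_subgroup_subset[OF normal_S])
  moreover have "N n \<subseteq> lcs G (Suc n)"
    unfolding N_def lcs_Suc_eq by (rule cmt_subgroup_mono) (simp add: S_def)
  ultimately show ?thesis by (auto simp: S_def)
qed

lemma S_carrier: "x \<in> S n \<Longrightarrow> x \<in> carrier G"
  by (auto simp: S_def lcs_carrier)

lemma central_mod_N: "z \<in> S n \<Longrightarrow> central_elt (G Mod N n) (N n #> z)"
  using S_carrier
  by (intro normal.central_elt_Mod[OF normal_N]) (auto simp: N_def cmt_in_cmt_subgroup)

lemma a_b_carrier [simp]: "a \<in> carrier G" "b \<in> carrier G"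
  by (fact generators)+

lemma A_carrier: "x \<in> A \<Longrightarrow> x \<in> carrier G"
  using A(1) normal_imp_subgroup subgroup.mem_carrier by metis

text \<open>Since [x,y] is central modulo \<open>N m\<close>, conjugating both entries by
  \<open>b\<close> does not change it. Conjugation of \<open>y\<close> by \<open>b\<close> can thus
  be traded for conjugation of \<open>x\<close> by the inverse of \<open>b\<close>: commutation with
  \<open>b\<close> is adjoint to commutation with \<open>inv b\<close>.\<close>

lemma shift_commutator:
  assumes x: "x \<in> A" and y: "y \<in> A" "y \<in> lcs G m"
  shows "N m #> cmt G x (cmt G y b) = N m #> cmt G (cmt G x (inv b)) y"
proof -
  interpret N: normal "N m" G by (rule normal_N)
  interpret A: normal A G by (rule A(1))
  interpret L: normal "lcs G m" G by (rule normal_lcs)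
  interpret \<pi>: group_hom G "G Mod N m" "\<lambda>x. N m #> x" by (rule N.group_hom_Mod)
  have cS: "cmt G x y \<in> S m" if "x \<in> A" "y \<in> A" "y \<in> lcs G m" for x y
    using that R(2) A_carrier cmt_in_normal(2)[OF normal_lcs] by (auto simp: S_def)
  have central: "central_elt (G Mod N m) (cmt (G Mod N m) (N m #> x) (N m #> y))"
    if "x \<in> A" "y \<in> A" "y \<in> lcs G m" for x y
    using central_mod_N[OF cS[OF that]] that A_carrier by (simp add: \<pi>.hom_cmt)
  define x' where "x' = inv b \<otimes> x \<otimes> b"
  define y' where "y' = b \<otimes> y \<otimes> inv b"
  have x'A: "x' \<in> A" using x by (simp add: x'_def A.inv_op_closed1)
  have y'A: "y' \<in> A" "y' \<in> lcs G m" using y by (simp_all add: y'_def A.inv_op_closed2 L.inv_op_closed2)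
  have "cmt G y b = y \<otimes> inv y'"
    using y A_carrier by (simp add: cmt_def y'_def group_word)
  then have "N m #> cmt G x (cmt G y b) = (N m #> cmt G x y) \<otimes>\<^bsub>G Mod N m\<^esub> inv\<^bsub>G Mod N m\<^esub> (N m #> cmt G x y')"
    using central[OF x y'A] x y y'A A_carrier
    by (simp add: \<pi>.hom_cmt \<pi>.H.cmt_right_div_central)
  moreover have "N m #> cmt G x y' = N m #> cmt G x' y"
  proof -
    have "cmt G x y' = b \<otimes> cmt G x' y \<otimes> inv b"
      using x y A_carrier by (simp add: cmt_def x'_def y'_def group_word)
    then show ?thesis
      using \<pi>.H.central_eltD(3)[OF central_mod_N[OF cS[OF x'A y]], of "N m #> b"] x'A y A_carrier by simp
  qed
  moreover have "cmt G x (inv b) = x \<otimes> inv x'"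
    using x A_carrier by (simp add: cmt_def x'_def group_word)
  then have "N m #> cmt G (cmt G x (inv b)) y = (N m #> cmt G x y) \<otimes>\<^bsub>G Mod N m\<^esub> inv\<^bsub>G Mod N m\<^esub> (N m #> cmt G x' y)"
    using central[OF x'A y] x y x'A A_carrier
    by (simp add: \<pi>.hom_cmt \<pi>.H.cmt_left_div_central)
  ultimately show ?thesis by simp
qed

text \<open>Starting from \<open>a\<close>, there are m commutations with \<open>inv b\<close> and,
  for \<open>eta\<close>, then m with \<open>b\<close>. Their images in the power series are (1 -
  e^(-x))^m and ((1 - e^x)(1 - e^(-x)))^m.\<close>

definition xi :: "nat \<Rightarrow> 'a" where "xi m = ((\<lambda>x. cmt G x (inv b)) ^^ m) a"
definition eta :: "nat \<Rightarrow> 'a" where "eta m = ((\<lambda>x. cmt G x b) ^^ m) (xi m)"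

lemma xi_mem: "xi m \<in> A \<inter> lcs G m"
proof (induction m)
  case 0 then show ?case using A by (simp add: xi_def)
next
  case (Suc m)
  then show ?case using cmt_in_normal(1)[OF A(1), of "xi m" "inv b"] cmt_in_lcs[of "xi m" m "inv b"]
    by (simp add: xi_def)
qed

lemma iterated_eta_mem: "((\<lambda>x. cmt G x b) ^^ i) (xi m) \<in> A \<inter> lcs G m"
proof (induction i)
  case 0 then show ?case using xi_mem by simp
next
  case (Suc m)
  then show ?case using cmt_in_normal(1)[OF A(1)] cmt_in_normal(1)[OF normal_lcs] by simp
qed

lemma eta_mem: "eta m \<in> A" "eta m \<in> lcs G m"
  using iterated_eta_mem by (auto simp: eta_def)

text \<open>The m commutations with \<open>b\<close> move one at a time to the left entry, where
  they become commutations with \<open>inv b\<close>. At the end both entries are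
  \<open>xi m\<close>, and the commutator is trivial.\<close>

lemma cmt_a_eta: "cmt G a (eta m) \<in> N m"
proof -
  interpret N: normal "N m" G by (rule normal_N)
  have "N m #> cmt G (xi j) (((\<lambda>x. cmt G x b) ^^ i) (xi m)) = \<one>\<^bsub>G Mod N m\<^esub>" if "i + j = m" for i j
    using that
  proof (induction i arbitrary: j)
    case 0
    then show ?case using xi_mem A_carrier N.rcos_eq_self_iff by simp
  next
    case (Suc i)
    have "N m #> cmt G (xi j) (((\<lambda>x. cmt G x b) ^^ Suc i) (xi m))
        = N m #> cmt G (xi (Suc j)) (((\<lambda>x. cmt G x b) ^^ i) (xi m))"
      using shift_commutator[of "xi j" _ m] xi_mem[of j] iterated_eta_mem[of i m] by (simp add: xi_def)
    then show ?case using Suc by simp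
  qed
  from this[of m 0] have "N m #> cmt G a (eta m) = \<one>\<^bsub>G Mod N m\<^esub>"
    by (simp add: eta_def) (simp add: xi_def)
  then show ?thesis
    using N.rcos_eq_self_iff eta_mem A_carrier by simp
qed

text \<open>Stages of the infinite product of the \<open>eta n\<close> with \<open>n\<close> in
  \<open>B\<close>, which converges since \<open>eta n\<close> lies in
  \<open>lcs G n\<close>.\<close>

primrec partial_prod :: "nat set \<Rightarrow> nat \<Rightarrow> 'a" where
  "partial_prod B 0 = \<one>"
| "partial_prod B (Suc n) = partial_prod B n \<otimes> (if n \<in> B then eta n else \<one>)"

lemma partial_prod_mem: "partial_prod B n \<in> A"
proof (induction n)
  interpret A: normal A G by (rule A(1))
  case 0 show ?case by simp
  case (Suc n) then show ?case using eta_mem by simp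
qed

text \<open>At each stage the error lies in \<open>N n\<close>, the commutator subgroup of
  \<open>S n\<close> with \<open>G\<close>, and is absorbed modulo \<open>N (Suc n)\<close> by
  multiplying \<open>k\<close> and \<open>l\<close> by elements of \<open>S n\<close>. Both
  sequences hence stay in \<open>R\<close>, and their changes lie ever deeper in the lower central
  series.\<close>

lemma commutator_with_partial_prod:
  "\<exists>k l. (\<forall>n. k n \<in> R \<and> l n \<in> R
     \<and> N n #> cmt G a (partial_prod B n) = N n #> (cmt G (k n) a \<otimes> cmt G (l n) b)
     \<and> (\<exists>r\<in>S n. k (Suc n) = k n \<otimes> r) \<and> (\<exists>s\<in>S n. l (Suc n) = l n \<otimes> s))"
proof -
  interpret R: normal R G by (rule R(1))
  interpret A: normal A G by (rule A(1))
  let ?P = "\<lambda>n kl. fst kl \<in> R \<and> snd kl \<in> R \<and> N n #> cmt G a (partial_prod B n) = N n #> (cmt G (fst kl) a \<otimes> cmt G (snd kl) b)"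
  let ?Q = "\<lambda>n kl kl'. (\<exists>r\<in>S n. fst kl' = fst kl \<otimes> r) \<and> (\<exists>s\<in>S n. snd kl' = snd kl \<otimes> s)"
  have "\<exists>f. \<forall>n. ?P n (f n) \<and> ?Q n (f n) (f (Suc n))"
  proof (rule dependent_nat_choice)
    show "\<exists>x. ?P 0 x" by (rule exI[of _ "(\<one>, \<one>)"]) simp
    fix kl n assume P: "?P n kl"
    define k where "k = fst kl"
    define l where "l = snd kl"
    have kl: "k \<in> R" "l \<in> R" using P by (simp_all add: k_def l_def)
    define h where "h = partial_prod B n"
    define h' where "h' = partial_prod B (Suc n)"
    have h: "h \<in> carrier G" "h' \<in> carrier G"
      using A_carrier[OF partial_prod_mem[of B n]] A_carrier[OF partial_prod_mem[of B "Suc n"]]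
      unfolding h_def h'_def by -
    \<comment> \<open>The error after passing to the next partial product. By
      \<open>cmt_a_eta\<close> the new factor is invisible modulo \<open>N n\<close>, so the error
      lies in \<open>N n\<close>.\<close>
    define \<delta> where "\<delta> = inv (cmt G k a \<otimes> cmt G l b) \<otimes> cmt G a h'"
    interpret N: normal "N n" G by (rule normal_N)
    interpret \<rho>: group_hom G "G Mod N n" "\<lambda>x. N n #> x" by (rule N.group_hom_Mod)
    have "N n #> cmt G a h' = N n #> cmt G a h"
    proof (cases "n \<in> B")
      case True
      then have h'eq: "h' = h \<otimes> eta n" by (simp add: h_def h'_def)
      have e: "N n #> cmt G a (eta n) = \<one>\<^bsub>G Mod N n\<^esub>"
        using cmt_a_eta N.rcos_eq_self_iff eta_mem A_carrier by simp
      show ?thesis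
        unfolding h'eq using e h eta_mem A_carrier by (simp add: cmt_mult_right)
    qed (use h in \<open>simp add: h_def h'_def\<close>)
    then have "N n #> \<delta> = \<one>\<^bsub>G Mod N n\<^esub>"
      using P h kl unfolding \<delta>_def h_def[symmetric] k_def[symmetric] l_def[symmetric]
      by (simp add: \<rho>.H.m_assoc)
    moreover have \<delta>c: "\<delta> \<in> carrier G" using h kl by (simp add: \<delta>_def)
    ultimately have "\<delta> \<in> cmt_subgroup G (S n)" using N.rcos_eq_self_iff by (simp add: N_def)
    then obtain r s where rs: "r \<in> S n" "s \<in> S n"
      and eq: "cmt_subgroup G (N n) #> \<delta> = cmt_subgroup G (N n) #> (cmt G r a \<otimes> cmt G s b)"
      using cmt_subgroup_two_generators[OF generators normal_S] unfolding N_def by blast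
    have rsR: "r \<in> R" "s \<in> R" using rs by (auto simp: S_def)
    interpret N': normal "N (Suc n)" G by (rule normal_N)
    interpret \<pi>: group_hom G "G Mod N (Suc n)" "\<lambda>x. N (Suc n) #> x" by (rule N'.group_hom_Mod)
    have "\<delta> \<otimes> inv (cmt G r a \<otimes> cmt G s b) \<in> cmt_subgroup G (N n)"
      using eq normal.rcos_eq_iff[OF normal_cmt_subgroup[OF normal_N[of n]], of \<delta> "cmt G r a \<otimes> cmt G s b"] \<delta>c rsR by simp
    \<comment> \<open>Here the precision improves: \<open>N n\<close> is contained in
      \<open>S (Suc n)\<close>, so its commutators lie in \<open>N (Suc n)\<close>.\<close>
    moreover have "cmt_subgroup G (N n) \<subseteq> N (Suc n)"
      unfolding N_def[of "Suc n"] by (rule cmt_subgroup_mono[OF N_subset])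
    ultimately have eq': "N (Suc n) #> \<delta> = N (Suc n) #> (cmt G r a \<otimes> cmt G s b)"
      using N'.rcos_eq_iff[of \<delta> "cmt G r a \<otimes> cmt G s b"] \<delta>c rsR by auto
    let ?c = "\<lambda>x y. cmt (G Mod N (Suc n)) (N (Suc n) #> x) (N (Suc n) #> y)"
    have central: "central_elt (G Mod N (Suc n)) (?c r g)" if "r \<in> S n" "g \<in> carrier G" for r g
    proof -
      have "cmt G r g \<in> S (Suc n)"
        using cmt_in_cmt_subgroup[OF that] N_subset unfolding N_def by blast
      from central_mod_N[OF this] show ?thesis
        using that S_carrier by (simp add: \<pi>.hom_cmt)
    qed
    have comm: "?c r a \<otimes>\<^bsub>G Mod N (Suc n)\<^esub> x = x \<otimes>\<^bsub>G Mod N (Suc n)\<^esub> ?c r a" if "x \<in> carrier (G Mod N (Suc n))" for x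
      using central[OF rs(1), of a] that by (simp add: central_elt_def)
    have "N (Suc n) #> (cmt G (k \<otimes> r) a \<otimes> cmt G (l \<otimes> s) b)
      = ?c k a \<otimes>\<^bsub>G Mod N (Suc n)\<^esub> (?c r a \<otimes>\<^bsub>G Mod N (Suc n)\<^esub> (?c l b \<otimes>\<^bsub>G Mod N (Suc n)\<^esub> ?c s b))"
      using kl rsR central rs by (simp add: \<pi>.hom_cmt \<pi>.H.cmt_left_central \<pi>.H.m_assoc)
    also have "\<dots> = ?c k a \<otimes>\<^bsub>G Mod N (Suc n)\<^esub> (?c l b \<otimes>\<^bsub>G Mod N (Suc n)\<^esub> (?c r a \<otimes>\<^bsub>G Mod N (Suc n)\<^esub> ?c s b))"
      using kl rsR comm[of "?c l b"] by (simp flip: \<pi>.H.m_assoc)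
    also have "\<dots> = N (Suc n) #> (cmt G k a \<otimes> cmt G l b \<otimes> (cmt G r a \<otimes> cmt G s b))"
      using kl rsR by (simp add: \<pi>.hom_cmt \<pi>.H.m_assoc)
    also have "\<dots> = (N (Suc n) #> (cmt G k a \<otimes> cmt G l b)) \<otimes>\<^bsub>G Mod N (Suc n)\<^esub> (N (Suc n) #> \<delta>)"
      using kl rsR unfolding eq' by simp
    also have "\<dots> = N (Suc n) #> (cmt G k a \<otimes> cmt G l b \<otimes> \<delta>)"
      using kl \<delta>c by simp
    also have "cmt G k a \<otimes> cmt G l b \<otimes> \<delta> = cmt G a h'"
      unfolding \<delta>_def using kl h by (simp add: group_word)
    finally have "?P (Suc n) (k \<otimes> r, l \<otimes> s)"
      using kl rsR by (simp add: h'_def)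
    then show "\<exists>kl'. ?P (Suc n) kl' \<and> ?Q n kl kl'"
      using rs by (intro exI[of _ "(k \<otimes> r, l \<otimes> s)"]) (auto simp: k_def l_def)
  qed
  then obtain f where f: "\<forall>n. ?P n (f n) \<and> ?Q n (f n) (f (Suc n))" ..
  show ?thesis
    by (rule exI[of _ "\<lambda>n. fst (f n)"], rule exI[of _ "\<lambda>n. snd (f n)"]) (use f in blast)
qed

end

section \<open>The cocycle on the completion\<close>

lemma trunc_ext: "(\<And>i. i > 0 \<Longrightarrow> trunc i x = trunc i y) \<Longrightarrow> x = y"
proof -
  assume *: "\<And>i. i > 0 \<Longrightarrow> trunc i x = trunc i y"
  have "fst x $ j = fst y $ j" for j
    using arg_cong[OF *[of "Suc j"], of "\<lambda>z. fst z $ j"] by (simp add: trunc_def)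
  moreover have "snd x = snd y" using *[of 1] by (simp add: trunc_def)
  ultimately show "x = y" by (simp add: prod_eq_iff fps_eq_iff)
qed

text \<open>\<open>exp_semidirect\<close> is the inverse limit of its truncations. The truncations
  of \<open>\<phi>\<close> extend over the tower, uniqueness of the extensions makes them
  compatible, and they glue. Levels start at 1, where the truncated group is nilpotent of the right
  class.\<close>

lemma Q_completion_hom:
  assumes T: "Q_completion_tower G M e p" and G: "group G" and \<phi>: "\<phi> \<in> hom G exp_semidirect"
  obtains \<Phi> where "\<Phi> \<in> hom (inv_limit M p) exp_semidirect"
    "\<And>m i x. m \<in> carrier (inv_limit M p) \<Longrightarrow> i > 0 \<Longrightarrow> x \<in> carrier G \<Longrightarrow> m i = e i (lcs G i #>\<^bsub>G\<^esub> x) \<Longrightarrow>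
      trunc i (\<Phi> m) = trunc i (\<phi> x)"
proof -
  have tr: "trunc i \<in> hom exp_semidirect (exp_semidirect_trunc i)" for i
    using trunc_hom[of i] by (simp add: group_hom_def group_hom_axioms_def)
  have "\<exists>\<psi>. \<psi> \<in> hom (M i) (exp_semidirect_trunc i) \<and> (\<forall>x\<in>carrier G. \<psi> (e i (lcs G i #>\<^bsub>G\<^esub> x)) = trunc i (\<phi> x))"
    if "i > 0" for i
  proof -
    have h: "trunc i \<circ> \<phi> \<in> hom G (exp_semidirect_trunc i)" using hom_compose[OF \<phi> tr] .
    show ?thesis
      by (rule Q_completion_tower_extend[OF T G h nilpotent_exp_semidirect_trunc[OF that]
            uniquely_divisible_exp_semidirect_trunc lcs_exp_semidirect_trunc[OF that]]) auto
  qed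
  then obtain \<Psi> where \<Psi>: "\<And>i. i > 0 \<Longrightarrow> \<Psi> i \<in> hom (M i) (exp_semidirect_trunc i)"
    and \<Psi>e: "\<And>i x. i > 0 \<Longrightarrow> x \<in> carrier G \<Longrightarrow> \<Psi> i (e i (lcs G i #>\<^bsub>G\<^esub> x)) = trunc i (\<phi> x)"
    by metis
  have compat: "trunc i (\<Psi> (Suc i) m) = \<Psi> i (p i m)" if i: "i > 0" and m: "m \<in> carrier (M (Suc i))" for i m
  proof -
    have R: "rationalization (G Mod lcs G (Suc i)) (M (Suc i)) (e (Suc i))"
      and p: "p i \<in> hom (M (Suc i)) (M i)"
      and pe: "\<And>x. x \<in> carrier G \<Longrightarrow> p i (e (Suc i) (lcs G (Suc i) #>\<^bsub>G\<^esub> x)) = e i (lcs G i #>\<^bsub>G\<^esub> x)"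
      using T by (auto simp: Q_completion_tower_def)
    have h1: "trunc i \<circ> \<Psi> (Suc i) \<in> hom (M (Suc i)) (exp_semidirect_trunc i)"
      using hom_compose[OF \<Psi> trunc_hom_trunc] by simp
    have h2: "\<Psi> i \<circ> p i \<in> hom (M (Suc i)) (exp_semidirect_trunc i)"
      using hom_compose[OF p \<Psi>[OF i]] .
    have "(trunc i \<circ> \<Psi> (Suc i)) m = (\<Psi> i \<circ> p i) m"
    proof (rule rationalization_hom_eq[OF R h1 h2 group_exp_semidirect_trunc uniquely_divisible_exp_semidirect_trunc _ m])
      fix Z assume "Z \<in> carrier (G Mod lcs G (Suc i))"
      then obtain x where x: "x \<in> carrier G" "Z = lcs G (Suc i) #>\<^bsub>G\<^esub> x" by (auto simp: carrier_FactGroup)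
      show "(trunc i \<circ> \<Psi> (Suc i)) (e (Suc i) Z) = (\<Psi> i \<circ> p i) (e (Suc i) Z)"
        using x i by (simp add: \<Psi>e pe) (simp add: trunc_def fps_cutoff_cutoff)
    qed
    then show ?thesis by simp
  qed
  have Lmem: "m i \<in> carrier (M i)" "p i (m (Suc i)) = m i" if "m \<in> carrier (inv_limit M p)" for m i
    using that by (auto simp: inv_limit_def)
  have compat': "trunc i (\<Psi> j (m j)) = \<Psi> i (m i)"
    if "i \<le> j" "i > 0" and m: "m \<in> carrier (inv_limit M p)" for i j m
    using \<open>i \<le> j\<close>
  proof (induction rule: dec_induct)
    case base
    show ?case using hom_in_carrier[OF \<Psi>[OF \<open>i > 0\<close>] Lmem(1)[OF m]] by (rule trunc_id)
  next
    case (step j)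
    have "trunc i (\<Psi> (Suc j) (m (Suc j))) = trunc i (trunc j (\<Psi> (Suc j) (m (Suc j))))"
      using step by (simp add: trunc_def fps_cutoff_cutoff min_def)
    also have "\<dots> = trunc i (\<Psi> j (m j))"
      using compat[of j "m (Suc j)"] Lmem[OF m] step that by simp
    finally show ?case using step by simp
  qed
  \<comment> \<open>Coefficient \<open>j\<close> is read at level \<open>Suc j\<close>, the first
    level that retains it; the rational component, the same at all positive levels, is read at level
    1.\<close>
  define \<Phi> where "\<Phi> m = (Abs_fps (\<lambda>j. fst (\<Psi> (Suc j) (m (Suc j))) $ j), snd (\<Psi> 1 (m 1)))" for m
  have trunc_\<Phi>: "trunc i (\<Phi> m) = \<Psi> i (m i)" if i: "i > 0" and m: "m \<in> carrier (inv_limit M p)" for i m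
  proof -
    have id: "trunc i (\<Psi> i (m i)) = \<Psi> i (m i)" using compat'[OF _ i m] by simp
    have "fst (\<Psi> (Suc j) (m (Suc j))) $ j = fst (\<Psi> i (m i)) $ j" if "j < i" for j
      using arg_cong[OF compat'[of "Suc j" i m], of "\<lambda>z. fst z $ j"] that m by (simp add: trunc_def)
    then have "fps_cutoff i (fst (\<Phi> m)) = fps_cutoff i (fst (\<Psi> i (m i)))"
      by (simp add: \<Phi>_def fps_eq_iff)
    moreover have "snd (\<Phi> m) = snd (\<Psi> i (m i))"
      using arg_cong[OF compat'[of 1 i m], of snd] i m by (simp add: trunc_def \<Phi>_def)
    ultimately show ?thesis using id by (simp add: trunc_def)
  qed
  have Lmult: "(m \<otimes>\<^bsub>inv_limit M p\<^esub> m') i = m i \<otimes>\<^bsub>M i\<^esub> m' i" for m m' i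
    by (simp add: inv_limit_def)
  have Lclosed: "m \<otimes>\<^bsub>inv_limit M p\<^esub> m' \<in> carrier (inv_limit M p)"
    if "m \<in> carrier (inv_limit M p)" "m' \<in> carrier (inv_limit M p)" for m m'
  proof -
    have gp: "group (M i)" "p i \<in> hom (M (Suc i)) (M i)" for i
      using T by (auto simp: Q_completion_tower_def rationalization_def nilpotent_group_def)
    have "m i \<otimes>\<^bsub>M i\<^esub> m' i \<in> carrier (M i)" for i
      using Lmem(1)[OF that(1)] Lmem(1)[OF that(2)] gp(1) by (intro monoid.m_closed group.is_monoid)
    moreover have "p i (m (Suc i) \<otimes>\<^bsub>M (Suc i)\<^esub> m' (Suc i)) = m i \<otimes>\<^bsub>M i\<^esub> m' i" for i
      using hom_mult[OF gp(2)[of i] Lmem(1)[OF that(1)] Lmem(1)[OF that(2)]] Lmem(2) that by simp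
    ultimately show ?thesis by (simp add: inv_limit_def)
  qed
  have "\<Phi> \<in> hom (inv_limit M p) exp_semidirect"
  proof (rule homI)
    fix m m' assume m: "m \<in> carrier (inv_limit M p)" "m' \<in> carrier (inv_limit M p)"
    show "\<Phi> (m \<otimes>\<^bsub>inv_limit M p\<^esub> m') = \<Phi> m \<otimes>\<^bsub>exp_semidirect\<^esub> \<Phi> m'"
    proof (rule trunc_ext)
      fix i :: nat assume i: "i > 0"
      have "trunc i (\<Phi> (m \<otimes>\<^bsub>inv_limit M p\<^esub> m')) = \<Psi> i (m i) \<otimes>\<^bsub>exp_semidirect_trunc i\<^esub> \<Psi> i (m' i)"
        using trunc_\<Phi>[OF i Lclosed[OF m]] hom_mult[OF \<Psi>[OF i]] Lmem m by (simp add: Lmult)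
      also have "\<dots> = trunc i (\<Phi> m \<otimes>\<^bsub>exp_semidirect\<^esub> \<Phi> m')"
        using trunc_\<Phi>[OF i] m hom_mult[OF tr[of i], of "\<Phi> m" "\<Phi> m'"] by simp
      finally show "trunc i (\<Phi> (m \<otimes>\<^bsub>inv_limit M p\<^esub> m')) = trunc i (\<Phi> m \<otimes>\<^bsub>exp_semidirect\<^esub> \<Phi> m')" .
    qed
  qed simp
  then show ?thesis using that trunc_\<Phi> \<Psi>e by metis
qed

section \<open>Evaluation of two-cochains on bar chains\<close>

definition cochain_eval :: "('a \<Rightarrow> 'a \<Rightarrow> rat fls) \<Rightarrow> ('a \<times> 'a \<Rightarrow> rat) \<Rightarrow> rat fls" where
  "cochain_eval c z = (\<Sum>q | z q \<noteq> 0. fls_const (z q) * c (fst q) (snd q))"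

lemma cochain_eval_superset:
  assumes "finite B" "{q. z q \<noteq> 0} \<subseteq> B"
  shows "cochain_eval c z = (\<Sum>q\<in>B. fls_const (z q) * c (fst q) (snd q))"
  unfolding cochain_eval_def using assms by (intro sum.mono_neutral_left) auto

lemma fls_const_diff: "fls_const (a - b) = fls_const a - fls_const (b::'a::ring_1)"
  by (simp add: fls_minus_const)

lemma cochain_eval_diff:
  assumes "finite {q. z q \<noteq> 0}" "finite {q. w q \<noteq> 0}"
  shows "cochain_eval c (z - w) = cochain_eval c z - cochain_eval c w"
proof -
  let ?B = "{q. z q \<noteq> 0} \<union> {q. w q \<noteq> 0}"
  have B: "finite ?B" using assms by simp
  have "cochain_eval c (z - w) = (\<Sum>q\<in>?B. fls_const ((z - w) q) * c (fst q) (snd q))"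
    by (rule cochain_eval_superset[OF B]) auto
  moreover have "cochain_eval c z = (\<Sum>q\<in>?B. fls_const (z q) * c (fst q) (snd q))"
    by (rule cochain_eval_superset[OF B]) auto
  moreover have "cochain_eval c w = (\<Sum>q\<in>?B. fls_const (w q) * c (fst q) (snd q))"
    by (rule cochain_eval_superset[OF B]) auto
  ultimately show ?thesis
    by (simp add: fls_const_diff left_diff_distrib sum_subtractf)
qed

lemma fls_const_sum: "fls_const (sum f A) = (\<Sum>x\<in>A. fls_const (f x :: 'a::ring_1))"
  by (induction A rule: infinite_finite_induct) (simp_all flip: fls_plus_const)

lemma sum_ind_eq:
  assumes "finite B" "u \<in> B"
  shows "(\<Sum>y\<in>B. fls_const (ind (u = y)) * f y) = f u"
proof -
  have "(\<Sum>y\<in>B. fls_const (ind (u = y)) * f y) = (\<Sum>y\<in>B. if u = y then f y else 0)"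
    by (intro sum.cong) (auto simp: ind_def)
  then show ?thesis using assms by simp
qed

text \<open>The assumption on \<open>c\<close> is the inhomogeneous 2-cocycle identity with trivial
  action; its left side is the value of \<open>c\<close> on the boundary of a single 3-simplex. A
  finite set \<open>B\<close> holding all faces makes the sums comparable.\<close>

lemma cochain_eval_boundary:
  assumes c: "\<And>x y w. x \<in> carrier L \<Longrightarrow> y \<in> carrier L \<Longrightarrow> w \<in> carrier L \<Longrightarrow>
      c y w - c (x \<otimes>\<^bsub>L\<^esub> y) w + c x (y \<otimes>\<^bsub>L\<^esub> w) - c x y = 0"
    and z: "z \<in> boundaries2 L"
  shows "cochain_eval c z = 0" "finite {q. z q \<noteq> 0}"
proof -
  obtain C where C: "finite {q. C q \<noteq> 0}" "{q. C q \<noteq> 0} \<subseteq> carrier L \<times> carrier L \<times> carrier L" "z = bar_d3 L C"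
    using z by (auto simp: boundaries2_def chains_def)
  define Q where "Q = {q. C q \<noteq> 0}"
  define d where "d q y = (case q of (g, h, k) \<Rightarrow> ind ((h, k) = y) - ind ((g \<otimes>\<^bsub>L\<^esub> h, k) = y)
       + ind ((g, h \<otimes>\<^bsub>L\<^esub> k) = y) - ind ((g, h) = y))" for q y
  define B where "B = (\<Union>q\<in>Q. case q of (g, h, k) \<Rightarrow> {(h, k), (g \<otimes>\<^bsub>L\<^esub> h, k), (g, h \<otimes>\<^bsub>L\<^esub> k), (g, h)})"
  have B: "finite B" using C(1) by (auto simp: B_def Q_def)
  have zy: "z y = (\<Sum>q\<in>Q. C q * d q y)" for y
    by (simp add: C(3) bar_d3_def Q_def d_def)
  have supp: "{q. z q \<noteq> 0} \<subseteq> B"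
  proof
    fix y assume "y \<in> {q. z q \<noteq> 0}"
    then have "\<exists>q\<in>Q. d q y \<noteq> 0" unfolding zy by (metis (mono_tags, lifting) mem_Collect_eq mult_zero_right sum.neutral)
    then show "y \<in> B" by (fastforce simp: d_def B_def ind_def split: if_splits)
  qed
  then show "finite {q. z q \<noteq> 0}" using B by (rule finite_subset)
  have inner: "(\<Sum>y\<in>B. fls_const (d q y) * c (fst y) (snd y)) = 0" if q: "q \<in> Q" for q
  proof -
    obtain g h k where ghk: "q = (g, h, k)" by (cases q)
    have car: "g \<in> carrier L" "h \<in> carrier L" "k \<in> carrier L" using q C(2) ghk by (auto simp: Q_def)
    have mem: "(h, k) \<in> B" "(g \<otimes>\<^bsub>L\<^esub> h, k) \<in> B" "(g, h \<otimes>\<^bsub>L\<^esub> k) \<in> B" "(g, h) \<in> B"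
      using q ghk by (auto simp: B_def intro!: bexI[of _ q])
    have "(\<Sum>y\<in>B. fls_const (d q y) * c (fst y) (snd y)) =
      (\<Sum>y\<in>B. fls_const (ind ((h, k) = y)) * c (fst y) (snd y))
      - (\<Sum>y\<in>B. fls_const (ind ((g \<otimes>\<^bsub>L\<^esub> h, k) = y)) * c (fst y) (snd y))
      + (\<Sum>y\<in>B. fls_const (ind ((g, h \<otimes>\<^bsub>L\<^esub> k) = y)) * c (fst y) (snd y))
      - (\<Sum>y\<in>B. fls_const (ind ((g, h) = y)) * c (fst y) (snd y))"
      by (simp add: d_def ghk fls_const_diff fls_plus_const[symmetric] distrib_right left_diff_distrib sum.distrib sum_subtractf)
    also have "\<dots> = 0" using c[OF car] by (simp add: sum_ind_eq[OF B] mem)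
    finally show ?thesis .
  qed
  have "cochain_eval c z = (\<Sum>y\<in>B. \<Sum>q\<in>Q. fls_const (C q) * (fls_const (d q y) * c (fst y) (snd y)))"
    unfolding cochain_eval_superset[OF B supp] zy
    by (simp add: fls_const_sum sum_distrib_right mult.assoc flip: fls_const_mult_const)
  also have "\<dots> = (\<Sum>q\<in>Q. fls_const (C q) * (\<Sum>y\<in>B. fls_const (d q y) * c (fst y) (snd y)))"
    by (subst sum.swap) (simp add: sum_distrib_left)
  also have "\<dots> = 0" using inner by simp
  finally show "cochain_eval c z = 0" .
qed

text \<open>Evaluation is constant on homology classes, so all its values are attained on one chosen
  representative per class.\<close>

lemma countable_cochain_eval_cycles:
  assumes c: "\<And>x y w. x \<in> carrier L \<Longrightarrow> y \<in> carrier L \<Longrightarrow> w \<in> carrier L \<Longrightarrow>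
      c y w - c (x \<otimes>\<^bsub>L\<^esub> y) w + c x (y \<otimes>\<^bsub>L\<^esub> w) - c x y = 0"
    and H: "countable (H2_rat L)"
  shows "countable (cochain_eval c ` cycles2 L)"
proof -
  define r where "r = {(a, b). a \<in> cycles2 L \<and> b \<in> cycles2 L \<and> a - b \<in> boundaries2 L}"
  have "(\<lambda>_. 0) \<in> boundaries2 L"
    unfolding boundaries2_def by (rule image_eqI[of _ _ "\<lambda>_. 0"]) (auto simp: bar_d3_def chains_def)
  then have refl: "(z, z) \<in> r" if "z \<in> cycles2 L" for z
    using that by (simp add: r_def fun_diff_def)
  have "cochain_eval c ` cycles2 L \<subseteq> (\<lambda>Z. cochain_eval c (SOME w. w \<in> Z)) ` H2_rat L"
  proof clarify
    fix z assume z: "z \<in> cycles2 L"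
    define w where "w = (SOME w. w \<in> r `` {z})"
    have "w \<in> r `` {z}" unfolding w_def by (rule someI[of "\<lambda>w. w \<in> r `` {z}" z]) (use refl[OF z] in simp)
    then have w: "w \<in> cycles2 L" "z - w \<in> boundaries2 L" by (simp_all add: r_def)
    have "cochain_eval c (z - w) = cochain_eval c z - cochain_eval c w"
      using z w by (intro cochain_eval_diff) (auto simp: cycles2_def chains_def)
    then have "cochain_eval c z = cochain_eval c w"
      using cochain_eval_boundary(1)[of L c "z - w", OF c w(2)] by simp
    moreover have "r `` {z} \<in> H2_rat L" unfolding H2_rat_def r_def[symmetric] using z by (rule quotientI)
    ultimately show "cochain_eval c z \<in> (\<lambda>Z. cochain_eval c (SOME w. w \<in> Z)) ` H2_rat L"
      unfolding w_def by blast
  qed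
  then show ?thesis using H by (meson countable_image countable_subset)
qed

text \<open>Coefficients of repeated entries add up, so explicit chains can be written and evaluated
  without asking which simplices coincide.\<close>

definition list_chain :: "(rat \<times> 'c) list \<Rightarrow> 'c \<Rightarrow> rat" where
  "list_chain l y = (\<Sum>(r, u)\<leftarrow>l. r * ind (u = y))"

lemma list_chain_supp: "{y. list_chain l y \<noteq> 0} \<subseteq> snd ` set l"
proof
  fix y assume "y \<in> {y. list_chain l y \<noteq> 0}"
  then have "list_chain l y \<noteq> 0" by simp
  then show "y \<in> snd ` set l"
    by (induction l) (auto simp: list_chain_def ind_def split: if_splits)
qed

lemma finite_list_chain: "finite {y. list_chain l y \<noteq> 0}"
  using list_chain_supp by (rule finite_subset) simp

text \<open>The map \<open>\<iota>\<close> will be \<open>fls_const\<close> for evaluating cochains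
  and the identity for computing boundaries.\<close>

lemma sum_list_chain:
  fixes \<iota> :: "rat \<Rightarrow> 'r::comm_ring_1"
  assumes \<iota>: "\<iota> 0 = 0" "\<iota> 1 = 1" "\<And>x y. \<iota> (x + y) = \<iota> x + \<iota> y" "\<And>x y. \<iota> (x * y) = \<iota> x * \<iota> y"
  shows "(\<Sum>y | list_chain l y \<noteq> 0. \<iota> (list_chain l y) * f y) = (\<Sum>(r, u)\<leftarrow>l. \<iota> r * f u)"
proof -
  have "(\<Sum>y\<in>B. \<iota> (list_chain l y) * f y) = (\<Sum>(r, u)\<leftarrow>l. \<iota> r * f u)"
    if "finite B" "snd ` set l \<subseteq> B" for B
    using that(2)
  proof (induction l)
    case Nil
    then show ?case by (simp add: list_chain_def \<iota>)
  next
    case (Cons p l)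
    obtain r u where p: "p = (r, u)" by (cases p)
    have "(\<Sum>y\<in>B. \<iota> (list_chain (p # l) y) * f y)
      = (\<Sum>y\<in>B. \<iota> r * (\<iota> (ind (u = y)) * f y)) + (\<Sum>y\<in>B. \<iota> (list_chain l y) * f y)"
      by (simp add: list_chain_def p \<iota> distrib_right sum.distrib mult.assoc)
    also have "(\<Sum>y\<in>B. \<iota> r * (\<iota> (ind (u = y)) * f y)) = \<iota> r * (\<Sum>y\<in>B. if u = y then f y else 0)"
      by (simp add: sum_distrib_left[symmetric]) (auto simp: ind_def \<iota> intro!: sum.cong arg_cong[of _ _ "(*) (\<iota> r)"])
    also have "\<dots> = \<iota> r * f u" using Cons.prems that(1) p by simp
    finally show ?case using Cons p by simp
  qed
  from this[of "snd ` set l"] have "(\<Sum>y\<in>snd ` set l. \<iota> (list_chain l y) * f y) = (\<Sum>(r, u)\<leftarrow>l. \<iota> r * f u)"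
    by simp
  moreover have "(\<Sum>y | list_chain l y \<noteq> 0. \<iota> (list_chain l y) * f y) = (\<Sum>y\<in>snd ` set l. \<iota> (list_chain l y) * f y)"
    using list_chain_supp[of l] by (intro sum.mono_neutral_left) (auto simp: \<iota>)
  ultimately show ?thesis by simp
qed

lemma cochain_eval_list_chain:
  "cochain_eval c (list_chain l) = (\<Sum>(r, u)\<leftarrow>l. fls_const r * c (fst u) (snd u))"
  unfolding cochain_eval_def by (rule sum_list_chain) (simp_all add: fls_plus_const fls_const_mult_const)

lemma bar_d2_list_chain:
  "bar_d2 L (list_chain l) x = (\<Sum>(r, u)\<leftarrow>l. r * (ind (snd u = x) - ind (fst u \<otimes>\<^bsub>L\<^esub> snd u = x) + ind (fst u = x)))"
  unfolding bar_d2_def using sum_list_chain[of "\<lambda>x. x"] by simp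

text \<open>Up to boundaries, a commutator relation \<open>[x,y] = [k,x][l,w]\<close> is the chain
  \<open>\<kappa> x y - \<kappa> k x - \<kappa> l w - ([k,x],[l,w])\<close>, with \<open>\<kappa> u v = (u,v) - (v,u) - ([u,v],vu)\<close>.\<close>

definition relation_cycle :: "('a,'m) monoid_scheme \<Rightarrow> 'a \<Rightarrow> 'a \<Rightarrow> 'a \<Rightarrow> 'a \<Rightarrow> 'a \<Rightarrow> 'a \<Rightarrow> 'a \<Rightarrow> 'a \<Rightarrow> 'a \<times> 'a \<Rightarrow> rat" where
  "relation_cycle L x y c k c' l w c'' = list_chain
    [(1, (x, y)), (-1, (y, x)), (-1, (c, y \<otimes>\<^bsub>L\<^esub> x)),
     (-1, (k, x)), (1, (x, k)), (1, (c', x \<otimes>\<^bsub>L\<^esub> k)),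
     (-1, (l, w)), (1, (w, l)), (1, (c'', w \<otimes>\<^bsub>L\<^esub> l)), (-1, (c', c''))]"

text \<open>The boundary of \<open>\<kappa> u v\<close> is -[u,v], so the total boundary is -c + c'
  + c'' minus the boundary c'' - c'c'' + c' of the last pair; this vanishes as c = c'c''.
  Commutators enter through equations like xy = c(yx).\<close>

lemma relation_cycle:
  assumes "x \<in> carrier L" "y \<in> carrier L" "c \<in> carrier L" "k \<in> carrier L" "c' \<in> carrier L" "l \<in> carrier L"
    "w \<in> carrier L" "c'' \<in> carrier L" "y \<otimes>\<^bsub>L\<^esub> x \<in> carrier L" "x \<otimes>\<^bsub>L\<^esub> k \<in> carrier L" "w \<otimes>\<^bsub>L\<^esub> l \<in> carrier L"
    and "x \<otimes>\<^bsub>L\<^esub> y = c \<otimes>\<^bsub>L\<^esub> (y \<otimes>\<^bsub>L\<^esub> x)" "k \<otimes>\<^bsub>L\<^esub> x = c' \<otimes>\<^bsub>L\<^esub> (x \<otimes>\<^bsub>L\<^esub> k)"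
    "l \<otimes>\<^bsub>L\<^esub> w = c'' \<otimes>\<^bsub>L\<^esub> (w \<otimes>\<^bsub>L\<^esub> l)" "c = c' \<otimes>\<^bsub>L\<^esub> c''"
  shows "relation_cycle L x y c k c' l w c'' \<in> cycles2 L"
proof -
  have "relation_cycle L x y c k c' l w c'' \<in> chains (carrier L \<times> carrier L)"
    unfolding relation_cycle_def chains_def
  proof (intro CollectI conjI finite_list_chain order_trans[OF list_chain_supp])
  qed (use assms(1-11) in auto)
  moreover have "bar_d2 L (relation_cycle L x y c k c' l w c'') = (\<lambda>_. 0)"
    using assms(12-15) unfolding relation_cycle_def by (intro ext) (simp add: bar_d2_list_chain)
  ultimately show ?thesis by (simp add: cycles2_def)
qed

text \<open>The cup product of the crossed homomorphism \<open>fst\<close> with itself under the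
  form f(x) \<open>\<pi>\<close>(g(-x)). Composition with \<open>- fps_X\<close> is the substitution
  of -x.\<close>

definition exp_cocycle :: "(rat fls \<Rightarrow> rat fls) \<Rightarrow> rat fps \<times> rat \<Rightarrow> rat fps \<times> rat \<Rightarrow> rat fls" where
  "exp_cocycle \<pi> x y = fps_to_fls (fst x) * \<pi> (fps_to_fls ((fps_exp (snd x) * fst y) oo - fps_X))"

text \<open>All terms cancel once the form is known to be invariant: substitution turns e^(qx) into
  e^(-qx), which \<open>\<pi>\<close> lets pass by linearity and which cancels against the e^(qx) of
  the first argument.\<close>

lemma exp_cocycle:
  assumes add: "\<And>f g. \<pi> (f + g) = \<pi> f + \<pi> g" and lin: "\<And>q f. \<pi> (fps_to_fls (fps_exp q) * f) = fps_to_fls (fps_exp q) * \<pi> f"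
  shows "exp_cocycle \<pi> y w - exp_cocycle \<pi> (x \<otimes>\<^bsub>exp_semidirect\<^esub> y) w
    + exp_cocycle \<pi> x (y \<otimes>\<^bsub>exp_semidirect\<^esub> w) - exp_cocycle \<pi> x y = 0"
proof -
  obtain f q g r h s where xyw: "x = (f, q)" "y = (g, r)" "w = (h, s)" by (cases x, cases y, cases w)
  define \<sigma> where "\<sigma> f = fps_to_fls (f oo - fps_X)" for f :: "rat fps"
  have \<sigma>: "\<sigma> (f + g) = \<sigma> f + \<sigma> g" "\<sigma> (fps_exp q * f) = fps_to_fls (fps_exp (-q)) * \<sigma> f" for f g q
    by (simp_all add: \<sigma>_def fps_compose_add_distrib fps_compose_mult_distrib fls_times_fps_to_fls)
  have inv: "fps_to_fls (fps_exp q) * fps_to_fls (fps_exp (- q)) = 1"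
    by (simp add: fls_times_fps_to_fls[symmetric] fps_exp_add_mult[symmetric])
  have "fps_to_fls (fps_exp q * g) * \<pi> (\<sigma> (fps_exp (q + r) * h)) =
    (fps_to_fls (fps_exp q) * fps_to_fls (fps_exp (- q))) * (fps_to_fls g * \<pi> (\<sigma> (fps_exp r * h)))"
    unfolding fps_exp_add_mult mult.assoc[of "fps_exp q"] \<sigma>(2)[of q] lin
    by (simp add: fls_times_fps_to_fls mult_ac)
  then have *: "fps_to_fls (fps_exp q * g) * \<pi> (\<sigma> (fps_exp (q + r) * h)) = fps_to_fls g * \<pi> (\<sigma> (fps_exp r * h))"
    by (simp add: inv)
  have "fps_to_fls g * \<pi> (\<sigma> (fps_exp r * h)) - fps_to_fls (f + fps_exp q * g) * \<pi> (\<sigma> (fps_exp (q + r) * h))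
    + fps_to_fls f * \<pi> (\<sigma> (fps_exp q * (g + fps_exp r * h))) - fps_to_fls f * \<pi> (\<sigma> (fps_exp q * g)) = 0"
    using * by (simp add: distrib_left distrib_right \<sigma>(1) add fps_exp_add_mult mult.assoc)
  then show ?thesis by (simp add: exp_cocycle_def xyw \<sigma>_def)
qed

lemma free_basis_two_elements:
  assumes "group G" "free_basis G S" "\<not> cyclic_group G"
  obtains a b where "a \<in> S" "b \<in> S" "a \<noteq> b"
proof -
  interpret group G by fact
  have S: "S \<subseteq> carrier G" "generate G S = carrier G" using assms(2) by (simp_all add: free_basis_def)
  have "\<not> (\<exists>s. S \<subseteq> {s})"
  proof
    assume "\<exists>s. S \<subseteq> {s}"
    then consider "S = {}" | s where "S = {s}" by blast
    then obtain x where x: "x \<in> carrier G" "generate G {x} = carrier G"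
    proof cases
      case 1
      then show ?thesis using that[of "\<one>\<^bsub>G\<^esub>"] S generate_empty generate_one by simp
    next
      case 2
      then show ?thesis using that S by blast
    qed
    then have "carrier G = range (\<lambda>n::int. x [^]\<^bsub>G\<^esub> n)" using generate_pow[of x] by (simp add: full_SetCompr_eq)
    then show False using assms(3) x cyclic_group by blast
  qed
  then show ?thesis using that by blast
qed

lemma uncountable_nat_sets: "uncountable (UNIV :: nat set set)"
  using Cantors_theorem[of "UNIV :: nat set"] by (simp add: uncountable_def)

text \<open>Translated by one of its members, each fibre is embedded by \<open>h\<close> into the
  countable kernel \<open>K\<close>. A countable range would present all sets of naturals as a
  countable union of countable fibres.\<close>

lemma uncountable_range_additive:
  fixes \<pi> :: "'a::ab_group_add \<Rightarrow> 'b::ab_group_add" and h :: "nat set \<Rightarrow> 'a"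
  assumes add: "\<And>x y. \<pi> (x + y) = \<pi> x + \<pi> y" and ker: "\<And>x. \<pi> x = 0 \<longleftrightarrow> x \<in> K"
    and K: "countable K" and h: "inj h"
  shows "uncountable (range (\<lambda>B. \<pi> (h B)))"
proof
  assume *: "countable (range (\<lambda>B. \<pi> (h B)))"
  have diff: "\<pi> (x - y) = \<pi> x - \<pi> y" for x y using add[of "x - y" y] by (simp add: algebra_simps)
  have "countable {B. \<pi> (h B) = w}" for w
  proof (cases "\<exists>B. \<pi> (h B) = w")
    case True
    then obtain B0 where B0: "\<pi> (h B0) = w" ..
    have "(\<lambda>B. h B - h B0) ` {B. \<pi> (h B) = w} \<subseteq> K"
      using B0 by (auto simp: ker[symmetric] diff)
    moreover have "inj_on (\<lambda>B. h B - h B0) {B. \<pi> (h B) = w}"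
      using h by (auto simp: inj_on_def)
    ultimately show ?thesis using K by (meson countable_image_inj_on countable_subset)
  qed simp
  then have "countable (\<Union>w\<in>range (\<lambda>B. \<pi> (h B)). {B. \<pi> (h B) = w})"
    using * by blast
  moreover have "(\<Union>w\<in>range (\<lambda>B. \<pi> (h B)). {B. \<pi> (h B) = w}) = UNIV" by blast
  ultimately show False using uncountable_nat_sets by simp
qed

section \<open>Even power series in (1 - e^x)(1 - e^(-x))\<close>

definition even_exp :: "rat fps" where
  "even_exp = (1 - fps_exp 1) * (1 - fps_exp (- 1))"

lemma even_exp: "even_exp $ 0 = 0" "even_exp \<noteq> 0" "even_exp oo - fps_X = even_exp"
proof -
  show "even_exp $ 0 = 0" by (simp add: even_exp_def)
  have "fps_exp (1::rat) \<noteq> 1" "fps_exp (- 1::rat) \<noteq> 1" by simp_all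
  then show "even_exp \<noteq> 0" unfolding even_exp_def by (metis eq_iff_diff_eq_0 mult_eq_0_iff)
  show "even_exp oo - fps_X = even_exp"
    by (simp add: even_exp_def fps_compose_mult_distrib fps_compose_sub_distrib mult.commute)
qed

definition even_series :: "nat set \<Rightarrow> rat fps" where
  "even_series B = Abs_fps (\<lambda>n. if n \<in> B then 1 else 0) oo even_exp"

lemma even_series_even: "even_series B oo - fps_X = even_series B"
  unfolding even_series_def
  using fps_compose_assoc[of "- fps_X" even_exp "Abs_fps (\<lambda>n. if n \<in> B then 1 else 0)"] even_exp by simp

text \<open>Substituting a nonzero series without constant term is injective.\<close>

lemma inj_even_series: "inj even_series"
proof (rule injI)
  fix B C assume eq: "even_series B = even_series C"
  let ?f = "\<lambda>B. Abs_fps (\<lambda>n. if n \<in> B then 1 else 0 :: rat)"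
  have "(?f B - ?f C) oo even_exp = 0"
    using eq by (simp add: even_series_def fps_compose_sub_distrib)
  then have "?f B - ?f C = 0" using even_exp by (simp add: fps_compose_eq_0_iff)
  then have "?f B $ n = ?f C $ n" for n by simp
  then have "n \<in> B \<longleftrightarrow> n \<in> C" for n by (auto split: if_splits) (metis zero_neq_one)+
  then show "B = C" by blast
qed

text \<open>The k-th power of \<open>even_exp\<close> has no coefficients in degrees below k, so
  only the powers with k < i are seen below degree \<open>i\<close>.\<close>

lemma cutoff_even_series:
  "fps_cutoff i (even_series B) = fps_cutoff i (\<Sum>k<i. if k \<in> B then even_exp ^ k else 0)"
proof (rule fps_ext)
  fix j
  have "(\<Sum>k\<in>{0..j}. (if k \<in> B then 1 else 0) * (even_exp ^ k) $ j) = (\<Sum>k<i. (if k \<in> B then even_exp ^ k else 0) $ j)" if "j < i"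
    using that even_exp(1)
    by (intro sum.mono_neutral_cong_left) (auto intro!: startsby_zero_power_prefix[rule_format])
  then show "fps_cutoff i (even_series B) $ j = fps_cutoff i (\<Sum>k<i. if k \<in> B then even_exp ^ k else 0) $ j"
    by (simp add: even_series_def fps_compose_nth fps_sum_nth)
qed

text \<open>On the given cycle only the pair (x,y) contributes to the cocycle: it gives
  \<open>\<pi>\<close>(h), as h is even. The pair (y,x) gives h \<open>\<pi>\<close>(1) = 0, and
  each remaining pair has an entry over (0,0), which makes its value zero.\<close>

lemma relation_cycle_uncountable:
  fixes L :: "'a monoid"
  assumes \<Phi>: "\<Phi> \<in> hom L exp_semidirect"
    and cyc: "\<And>B. \<exists>x y c k c' l w c''. relation_cycle L x y c k c' l w c'' \<in> cycles2 L
      \<and> \<Phi> x = (1, 0) \<and> \<Phi> y = (even_series B, 0) \<and> (\<forall>v\<in>{c, k, c', l, c''}. \<Phi> v = (0, 0))"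
  shows "\<not> countable (H2_rat L)"
proof
  assume H: "countable (H2_rat L)"
  obtain \<pi> :: "rat fls \<Rightarrow> rat fls" where \<pi>: "\<And>x y. \<pi> (x + y) = \<pi> x + \<pi> y"
    "\<And>c x. c \<in> expo_field \<Longrightarrow> \<pi> (c * x) = c * \<pi> x" "\<And>x. \<pi> x = 0 \<longleftrightarrow> x \<in> expo_field"
    using subfield_projection[OF expo_field_closed] by blast
  have \<pi>0: "\<pi> 0 = 0" using \<pi>(1)[of 0 0] by simp
  have \<pi>1: "\<pi> 1 = 0" using \<pi>(3) expo_field_closed(1) by simp
  define c where "c x y = exp_cocycle \<pi> (\<Phi> x) (\<Phi> y)" for x y
  have coc: "c y w - c (x \<otimes>\<^bsub>L\<^esub> y) w + c x (y \<otimes>\<^bsub>L\<^esub> w) - c x y = 0"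
    if "x \<in> carrier L" "y \<in> carrier L" "w \<in> carrier L" for x y w
    using exp_cocycle[of \<pi> "\<Phi> y" "\<Phi> w" "\<Phi> x", OF \<pi>(1) \<pi>(2)[OF expo_field_exp]] that hom_mult[OF \<Phi>]
    by (simp add: c_def del: exp_semidirect_simps)
  have "\<pi> (fps_to_fls (even_series B)) \<in> cochain_eval c ` cycles2 L" for B
  proof -
    obtain x y d k c' l w c'' where z: "relation_cycle L x y d k c' l w c'' \<in> cycles2 L"
      and ph: "\<Phi> x = (1, 0)" "\<Phi> y = (even_series B, 0)" "\<Phi> d = (0, 0)" "\<Phi> k = (0, 0)" "\<Phi> c' = (0, 0)"
        "\<Phi> l = (0, 0)" "\<Phi> c'' = (0, 0)"
      using cyc[of B] by auto
    have "cochain_eval c (relation_cycle L x y d k c' l w c'') = \<pi> (fps_to_fls (even_series B))"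
      unfolding relation_cycle_def cochain_eval_list_chain
      by (simp add: c_def exp_cocycle_def ph \<pi>0 \<pi>1 even_series_even)
    then show ?thesis using z by (metis image_eqI)
  qed
  then have "range (\<lambda>B. \<pi> (fps_to_fls (even_series B))) \<subseteq> cochain_eval c ` cycles2 L" by blast
  moreover have "countable (cochain_eval c ` cycles2 L)"
    by (rule countable_cochain_eval_cycles[of L c, OF coc H])
  moreover have "uncountable (range (\<lambda>B. \<pi> (fps_to_fls (even_series B))))"
    using inj_even_series by (intro uncountable_range_additive[OF \<pi>(1,3) countable_expo_field]) (auto simp: inj_def)
  ultimately show False using countable_subset by blast
qed

section \<open>Elements of the completion from coherent sequences\<close>

definition coherent :: "('a,'m) monoid_scheme \<Rightarrow> (nat \<Rightarrow> 'a) \<Rightarrow> bool" where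
  "coherent G x \<longleftrightarrow> (\<forall>i. x i \<in> carrier G \<and> lcs G i #>\<^bsub>G\<^esub> x (Suc i) = lcs G i #>\<^bsub>G\<^esub> x i)"

text \<open>A coherent sequence represents a point of the inverse limit of the nilpotent quotients,
  and this is its image in the completion. Products and commutators can then be computed on
  representatives in \<open>G\<close>.\<close>

definition tower_elt :: "('a,'m) monoid_scheme \<Rightarrow> (nat \<Rightarrow> 'a set \<Rightarrow> 'b) \<Rightarrow> (nat \<Rightarrow> 'a) \<Rightarrow> nat \<Rightarrow> 'b" where
  "tower_elt G e x = (\<lambda>i. e i (lcs G i #>\<^bsub>G\<^esub> x i))"

context group
begin

lemma group_hom_Mod_lcs: "group_hom G (G Mod lcs G i) (\<lambda>x. lcs G i #> x)"
  by (rule normal.group_hom_Mod[OF normal_lcs])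

lemma coherent_const: "x \<in> carrier G \<Longrightarrow> coherent G (\<lambda>_. x)"
  by (simp add: coherent_def)

lemma coherent_mult: "coherent G x \<Longrightarrow> coherent G y \<Longrightarrow> coherent G (\<lambda>i. x i \<otimes> y i)"
  by (simp add: coherent_def group_hom.hom_mult[OF group_hom_Mod_lcs])

lemma coherent_cmt: "coherent G x \<Longrightarrow> coherent G y \<Longrightarrow> coherent G (\<lambda>i. cmt G (x i) (y i))"
  by (simp add: coherent_def group_hom.hom_cmt[OF group_hom_Mod_lcs])

lemma coherent_step:
  assumes "\<And>i. x i \<in> carrier G" "\<And>i. \<exists>r\<in>lcs G i. x (Suc i) = x i \<otimes> r"
  shows "coherent G x"
  unfolding coherent_def
proof (intro allI conjI assms(1))
  fix i
  obtain r where r: "r \<in> lcs G i" "x (Suc i) = x i \<otimes> r" using assms(2) by blast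
  interpret L: normal "lcs G i" G by (rule normal_lcs)
  interpret \<pi>: group_hom G "G Mod lcs G i" "\<lambda>x. lcs G i #> x" by (rule group_hom_Mod_lcs)
  have "lcs G i #> r = \<one>\<^bsub>G Mod lcs G i\<^esub>" using r L.rcos_eq_self_iff by simp
  then show "lcs G i #> x (Suc i) = lcs G i #> x i" using r assms(1)[of i] by simp
qed

lemma tower_elt_closed:
  assumes T: "Q_completion_tower G M e p" and x: "coherent G x"
  shows "tower_elt G e x \<in> carrier (inv_limit M p)"
proof -
  have "e i \<in> hom (G Mod lcs G i) (M i)" for i
    using T by (simp add: Q_completion_tower_def rationalization_def)
  then have "e i (lcs G i #> y) \<in> carrier (M i)" if "y \<in> carrier G" for i y
    using that hom_in_carrier by (fastforce simp: carrier_FactGroup)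
  moreover have "p i (e (Suc i) (lcs G (Suc i) #> y)) = e i (lcs G i #> y)" if "y \<in> carrier G" for i y
    using T that by (simp add: Q_completion_tower_def)
  ultimately show ?thesis
    using x by (simp add: coherent_def inv_limit_def tower_elt_def)
qed

lemma tower_elt_mult:
  assumes T: "Q_completion_tower G M e p" and xy: "\<And>i. x i \<in> carrier G" "\<And>i. y i \<in> carrier G"
  shows "tower_elt G e x \<otimes>\<^bsub>inv_limit M p\<^esub> tower_elt G e y = tower_elt G e (\<lambda>i. x i \<otimes> y i)"
proof
  fix i
  have e: "e i \<in> hom (G Mod lcs G i) (M i)"
    using T by (simp add: Q_completion_tower_def rationalization_def)
  interpret \<pi>: group_hom G "G Mod lcs G i" "\<lambda>x. lcs G i #> x" by (rule group_hom_Mod_lcs)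
  show "(tower_elt G e x \<otimes>\<^bsub>inv_limit M p\<^esub> tower_elt G e y) i = tower_elt G e (\<lambda>i. x i \<otimes> y i) i"
    using hom_mult[OF e \<pi>.hom_closed[OF xy(1)] \<pi>.hom_closed[OF xy(2)]] xy by (simp add: inv_limit_def tower_elt_def)
qed

text \<open>Commutators pass to the limit in the form xy = [x,y](yx), which is the form that
  \<open>relation_cycle\<close> takes as input.\<close>

lemma tower_elt_cmt_mult:
  assumes T: "Q_completion_tower G M e p" and xy: "\<And>i. x i \<in> carrier G" "\<And>i. y i \<in> carrier G"
  shows "tower_elt G e x \<otimes>\<^bsub>inv_limit M p\<^esub> tower_elt G e y =
    tower_elt G e (\<lambda>i. cmt G (x i) (y i)) \<otimes>\<^bsub>inv_limit M p\<^esub> (tower_elt G e y \<otimes>\<^bsub>inv_limit M p\<^esub> tower_elt G e x)"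
  using xy by (simp add: tower_elt_mult[OF T] cmt_mult[symmetric])

end

section \<open>Construction of the cycles in the completion of the free group\<close>

theorem theorem1:
  fixes F :: "('a, 'm) monoid_scheme"
    and M :: "nat \<Rightarrow> 'b monoid"
    and e :: "nat \<Rightarrow> 'a set \<Rightarrow> 'b"
    and p :: "nat \<Rightarrow> 'b \<Rightarrow> 'b"
  assumes "fg_free_group F"
    and "\<not> cyclic_group F"
    and "Q_completion_tower F M e p"
  shows "\<not> countable (H2_rat (inv_limit M p))"
proof -
  interpret F: group F using assms(1) by (simp add: fg_free_group_def)
  note T = assms(3)
  define L where "L = inv_limit M p"
  obtain S where S: "free_basis F S" using assms(1) by (auto simp: fg_free_group_def)
  obtain a b where ab: "a \<in> S" "b \<in> S" "a \<noteq> b"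
    using free_basis_two_elements[OF F.is_group S assms(2)] .
  have abF: "a \<in> carrier F" "b \<in> carrier F" using ab S by (auto simp: free_basis_def)
  obtain \<phi> where \<phi>: "\<phi> \<in> hom F exp_semidirect"
    and \<phi>S: "\<And>s. s \<in> S \<Longrightarrow> \<phi> s = (if s = a then (1, 0) else if s = b then (0, 1) else (0, 0))"
    by (rule free_basis_extend[OF F.is_group group_exp_semidirect S,
        of "\<lambda>s. if s = a then (1, 0) else if s = b then (0, 1) else (0, 0)"]) auto
  have \<phi>a: "\<phi> a = (1, 0)" and \<phi>b: "\<phi> b = (0, 1)" using \<phi>S ab by auto
  interpret \<phi>: group_hom F exp_semidirect \<phi> using \<phi> by unfold_locales
  \<comment> \<open>The correction argument works with exactly two generators, hence inside the
    subgroup generated by \<open>a\<close> and \<open>b\<close>. Its lower central series lies in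
    that of \<open>F\<close>, so approximations made there converge in the completion of
    \<open>F\<close>.\<close>
  define K where "K = generate F {a, b}"
  define G where "G = F\<lparr>carrier := K\<rparr>"
  have K: "subgroup K F" unfolding K_def using abF by (intro F.generate_is_subgroup) simp
  have KF: "x \<in> carrier F" if "x \<in> K" for x using subgroup.mem_carrier[OF K that] .
  have abK: "a \<in> K" "b \<in> K" unfolding K_def by (auto intro: generate.incl)
  interpret G: group G unfolding G_def using K by (rule F.subgroup_imp_group)
  have G_simps [simp]: "carrier G = K" "x \<otimes>\<^bsub>G\<^esub> y = x \<otimes>\<^bsub>F\<^esub> y" "\<one>\<^bsub>G\<^esub> = \<one>\<^bsub>F\<^esub>" for x y
    by (simp_all add: G_def)
  have inv_G: "inv\<^bsub>G\<^esub> x = inv\<^bsub>F\<^esub> x" if "x \<in> K" for x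
    unfolding G_def using F.m_inv_consistent[OF K that] .
  have cmt_G: "cmt G x y = cmt F x y" if "x \<in> K" "y \<in> K" for x y
    using that by (simp add: cmt_def inv_G)
  interpret \<phi>G: group_hom G exp_semidirect \<phi>
    by unfold_locales (auto simp: hom_def KF)
  define A where "A = {g \<in> K. snd (\<phi> g) = 0}"
  define R where "R = {g \<in> K. \<phi> g = (0, 0)}"
  have A: "A \<lhd> G"
  proof (rule G.normal_invI)
    have A_eq: "A = {g \<in> carrier G. snd (\<phi> g) = 0}" by (simp add: A_def)
    show "subgroup A G"
      by unfold_locales (auto simp: A_eq inv_exp_semidirect simp del: G_simps)
    show "x \<otimes>\<^bsub>G\<^esub> h \<otimes>\<^bsub>G\<^esub> inv\<^bsub>G\<^esub> x \<in> A" if "x \<in> carrier G" "h \<in> A" for x h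
      using that by (auto simp: A_eq inv_exp_semidirect simp del: G_simps)
  qed
  have R: "R \<lhd> G"
    using \<phi>G.normal_kernel by (simp add: R_def kernel_def)
  interpret tg: two_generated_group G a b A R
  proof (intro two_generated_group.intro two_generated_group_axioms.intro G.is_group)
    show "a \<in> carrier G" "b \<in> carrier G" using abK by simp_all
    show "generate G {a, b} = carrier G"
      unfolding G_def using F.generate_consistent[OF _ K, of "{a, b}"] abK by (simp add: K_def)
    show "A \<lhd> G" "R \<lhd> G" by fact+
    show "a \<in> A" using abK \<phi>a by (simp add: A_def)
    show "cmt G x y \<in> R" if "x \<in> A" "y \<in> A" for x y
      using that G.cmt_closed[of x y] \<phi>G.hom_cmt[of x y] by (simp add: A_def R_def cmt_exp_semidirect)
  qed
  have AK: "x \<in> A \<Longrightarrow> x \<in> K" and RK: "x \<in> R \<Longrightarrow> x \<in> K" for x by (simp_all add: A_def R_def)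
  have \<phi>cmt: "\<phi> (cmt G x y) = ((1 - fps_exp (snd (\<phi> y))) * fst (\<phi> x) - (1 - fps_exp (snd (\<phi> x))) * fst (\<phi> y), 0)"
    if "x \<in> K" "y \<in> K" for x y
    using that \<phi>G.hom_cmt[of x y] by (simp add: cmt_exp_semidirect)
  \<comment> \<open>Over (0,-1), commutation with \<open>inv b\<close> multiplies the series by 1 -
    e^(-x); in the next claim commutation with \<open>b\<close> multiplies it by 1 - e^x.\<close>
  have \<phi>xi: "\<phi> (tg.xi m) = ((1 - fps_exp (- 1)) ^ m, 0)" for m
  proof (induction m)
    case 0 then show ?case by (simp add: tg.xi_def \<phi>a)
  next
    case (Suc m)
    have "inv\<^bsub>G\<^esub> b \<in> K" "\<phi> (inv\<^bsub>G\<^esub> b) = (0, - 1)"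
      using abK \<phi>G.hom_inv[of b] G.inv_closed[of b] by (simp_all add: \<phi>b inv_exp_semidirect)
    moreover have "tg.xi (Suc m) = cmt G (tg.xi m) (inv\<^bsub>G\<^esub> b)" by (simp add: tg.xi_def)
    ultimately show ?case using \<phi>cmt[of "tg.xi m" "inv\<^bsub>G\<^esub> b"] tg.xi_mem[of m] Suc AK by simp
  qed
  have "\<phi> (((\<lambda>x. cmt G x b) ^^ i) (tg.xi m)) = ((1 - fps_exp 1) ^ i * (1 - fps_exp (- 1)) ^ m, 0)" for i m
  proof (induction i)
    case 0 then show ?case by (simp add: \<phi>xi)
  next
    case (Suc i)
    then show ?case using \<phi>cmt[of "((\<lambda>x. cmt G x b) ^^ i) (tg.xi m)" b] tg.iterated_eta_mem[of i m] AK abK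
      by (simp add: \<phi>b mult.assoc)
  qed
  then have \<phi>eta: "\<phi> (tg.eta m) = (even_exp ^ m, 0)" for m
    by (simp add: tg.eta_def even_exp_def power_mult_distrib)
  have \<phi>pp: "\<phi> (tg.partial_prod B n) = (\<Sum>k<n. if k \<in> B then even_exp ^ k else 0, 0)" for B n
  proof (induction n)
    case 0 then show ?case using \<phi>G.hom_one by simp
  next
    case (Suc n)
    have "tg.partial_prod B n \<in> carrier F" "tg.eta n \<in> carrier F"
      using tg.partial_prod_mem tg.eta_mem(1) AK KF by blast+
    then show ?case using Suc by (simp add: \<phi>eta)
  qed
  have lcs_GF: "lcs G i \<subseteq> lcs F i" for i
    unfolding G_def by (rule lcs_subgroup_subset[OF F.is_group K])
  obtain \<Phi> where \<Phi>: "\<Phi> \<in> hom L exp_semidirect"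
    and tr\<Phi>: "\<And>m i x. m \<in> carrier L \<Longrightarrow> i > 0 \<Longrightarrow> x \<in> carrier F \<Longrightarrow> m i = e i (lcs F i #>\<^bsub>F\<^esub> x) \<Longrightarrow>
      trunc i (\<Phi> m) = trunc i (\<phi> x)"
    unfolding L_def using Q_completion_hom[OF T F.is_group \<phi>] by blast
  \<comment> \<open>The value of \<open>\<Phi>\<close> on a coherent sequence is determined by the
    positive truncations of \<open>\<phi>\<close> along it.\<close>
  have \<Phi>_tower: "\<Phi> (tower_elt F e x) = d"
    if "coherent F x" "\<And>i. i > 0 \<Longrightarrow> trunc i (\<phi> (x i)) = trunc i d" for x d
  proof (rule trunc_ext)
    fix i :: nat assume "i > 0"
    then show "trunc i (\<Phi> (tower_elt F e x)) = trunc i d"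
      using tr\<Phi>[OF F.tower_elt_closed[OF T that(1), folded L_def], of i "x i"] that
      by (simp add: coherent_def tower_elt_def)
  qed
  have "\<not> countable (H2_rat L)"
  proof (rule relation_cycle_uncountable[OF \<Phi>])
    fix B
    define h where "h = tg.partial_prod B"
    obtain k l where kl: "\<And>n. k n \<in> R" "\<And>n. l n \<in> R"
      and rel: "\<And>n. tg.N n #>\<^bsub>G\<^esub> cmt G a (h n) = tg.N n #>\<^bsub>G\<^esub> (cmt G (k n) a \<otimes>\<^bsub>G\<^esub> cmt G (l n) b)"
      and step: "\<And>n. \<exists>r\<in>tg.S n. k (Suc n) = k n \<otimes>\<^bsub>G\<^esub> r" "\<And>n. \<exists>s\<in>tg.S n. l (Suc n) = l n \<otimes>\<^bsub>G\<^esub> s"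
      using tg.commutator_with_partial_prod[of B] unfolding h_def by blast
    have hK: "h n \<in> K" for n using tg.partial_prod_mem AK by (simp add: h_def)
    have klK: "k n \<in> K" "l n \<in> K" for n using kl RK by auto
    note cl = KF[OF hK] KF[OF klK(1)] KF[OF klK(2)] abF
    have tgS: "tg.S n \<subseteq> lcs F n" for n using lcs_GF by (auto simp: tg.S_def)
    have coh: "coherent F (\<lambda>_. a)" "coherent F (\<lambda>_. b)" "coherent F h" "coherent F k" "coherent F l"
    proof -
      show "coherent F (\<lambda>_. a)" "coherent F (\<lambda>_. b)" using abF by (simp_all add: F.coherent_const)
      show "coherent F h"
      proof (rule F.coherent_step)
        fix n
        have "(if n \<in> B then tg.eta n else \<one>\<^bsub>F\<^esub>) \<in> lcs F n"
          using tg.eta_mem lcs_GF subgroup.one_closed[OF normal_imp_subgroup[OF F.normal_lcs]] by auto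
        then show "\<exists>r\<in>lcs F n. h (Suc n) = h n \<otimes>\<^bsub>F\<^esub> r" unfolding h_def by auto
      qed (rule cl)
      show "coherent F k" "coherent F l"
        using step tgS cl by (auto intro!: F.coherent_step) blast+
    qed
    define c c' c'' where "c = (\<lambda>i. cmt F a (h i))" and "c' = (\<lambda>i. cmt F (k i) a)" and "c'' = (\<lambda>i. cmt F (l i) b)"
    have coh_c: "coherent F c" "coherent F c'" "coherent F c''"
      unfolding c_def c'_def c''_def using coh by (auto intro: F.coherent_cmt)
    have cK: "c n \<in> R" "c' n \<in> R" "c'' n \<in> R" for n
    proof -
      have "cmt G a (h n) \<in> R"
        using tg.R(2)[OF tg.A(2) tg.partial_prod_mem] by (simp add: h_def)
      then show "c n \<in> R" using cmt_G[OF abK(1) hK] by (simp add: c_def)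
      show "c' n \<in> R" "c'' n \<in> R"
        using G.cmt_in_normal(1)[OF R kl(1), of a n] G.cmt_in_normal(1)[OF R kl(2), of b n] abK klK
        by (simp_all add: c'_def c''_def cmt_G)
    qed
    note ccl = KF[OF RK[OF cK(1)]] KF[OF RK[OF cK(2)]] KF[OF RK[OF cK(3)]]
    \<comment> \<open>\<open>tg.N i\<close> is contained in \<open>lcs F i\<close>, so the
      approximate relations at all stages become one exact relation [a,H] = [k,a][l,b] in the
      completion.\<close>
    have "lcs F i #>\<^bsub>F\<^esub> c i = lcs F i #>\<^bsub>F\<^esub> (c' i \<otimes>\<^bsub>F\<^esub> c'' i)" for i
    proof -
      have mem: "c i \<in> carrier G" "c' i \<otimes>\<^bsub>G\<^esub> c'' i \<in> carrier G"
        using RK[OF cK(1)] RK[OF cK(2)] RK[OF cK(3)] subgroup.m_closed[OF K] by auto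
      have "tg.N i #>\<^bsub>G\<^esub> c i = tg.N i #>\<^bsub>G\<^esub> (c' i \<otimes>\<^bsub>G\<^esub> c'' i)"
        using rel[of i] hK klK abK by (simp add: c_def c'_def c''_def cmt_G)
      then have "c i \<otimes>\<^bsub>G\<^esub> inv\<^bsub>G\<^esub> (c' i \<otimes>\<^bsub>G\<^esub> c'' i) \<in> tg.N i"
        using normal.rcos_eq_iff[OF tg.normal_N mem] by simp
      moreover have "tg.N i \<subseteq> lcs F i"
        using tg.N_subset[of i] tgS[of "Suc i"] F.lcs_Suc_subset[of i] by blast
      ultimately have "c i \<otimes>\<^bsub>F\<^esub> inv\<^bsub>F\<^esub> (c' i \<otimes>\<^bsub>F\<^esub> c'' i) \<in> lcs F i"
        using mem inv_G by auto
      then show ?thesis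
        using normal.rcos_eq_iff[OF F.normal_lcs, of "c i" "c' i \<otimes>\<^bsub>F\<^esub> c'' i" i] ccl by simp
    qed
    then have cc: "tower_elt F e c = tower_elt F e c' \<otimes>\<^bsub>L\<^esub> tower_elt F e c''"
      unfolding L_def using F.tower_elt_mult[OF T ccl(2,3)] by (simp add: tower_elt_def)
    define \<iota> where "\<iota> = tower_elt F e"
    have closed: "\<iota> x \<in> carrier L" if "coherent F x" for x
      unfolding \<iota>_def L_def using T that by (rule F.tower_elt_closed)
    have mult_closed: "\<iota> x \<otimes>\<^bsub>L\<^esub> \<iota> y \<in> carrier L" if "coherent F x" "coherent F y" for x y
      using closed[OF F.coherent_mult[OF that]] that F.tower_elt_mult[OF T, of x y]
      by (simp add: \<iota>_def L_def coherent_def)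
    have comm_rel: "\<iota> x \<otimes>\<^bsub>L\<^esub> \<iota> y = \<iota> (\<lambda>i. cmt F (x i) (y i)) \<otimes>\<^bsub>L\<^esub> (\<iota> y \<otimes>\<^bsub>L\<^esub> \<iota> x)"
      if "coherent F x" "coherent F y" for x y
      using F.tower_elt_cmt_mult[OF T, of x y] that by (simp add: \<iota>_def L_def coherent_def)
    have "relation_cycle L (\<iota> (\<lambda>_. a)) (\<iota> h) (\<iota> c) (\<iota> k) (\<iota> c') (\<iota> l) (\<iota> (\<lambda>_. b)) (\<iota> c'') \<in> cycles2 L"
    proof (rule relation_cycle)
      show "\<iota> (\<lambda>_. a) \<otimes>\<^bsub>L\<^esub> \<iota> h = \<iota> c \<otimes>\<^bsub>L\<^esub> (\<iota> h \<otimes>\<^bsub>L\<^esub> \<iota> (\<lambda>_. a))"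
        "\<iota> k \<otimes>\<^bsub>L\<^esub> \<iota> (\<lambda>_. a) = \<iota> c' \<otimes>\<^bsub>L\<^esub> (\<iota> (\<lambda>_. a) \<otimes>\<^bsub>L\<^esub> \<iota> k)"
        "\<iota> l \<otimes>\<^bsub>L\<^esub> \<iota> (\<lambda>_. b) = \<iota> c'' \<otimes>\<^bsub>L\<^esub> (\<iota> (\<lambda>_. b) \<otimes>\<^bsub>L\<^esub> \<iota> l)"
        using comm_rel[OF coh(1,3)] comm_rel[OF coh(4,1)] comm_rel[OF coh(5,2)]
        by (simp_all add: c_def c'_def c''_def)
      show "\<iota> c = \<iota> c' \<otimes>\<^bsub>L\<^esub> \<iota> c''" using cc by (simp add: \<iota>_def)
    qed (intro closed mult_closed coh coh_c)+
    moreover have "\<Phi> (\<iota> x) = (0, 0)" if "coherent F x" "\<And>n. x n \<in> R" for x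
      unfolding \<iota>_def using that by (intro \<Phi>_tower) (auto simp: R_def)
    then have "\<forall>v\<in>{\<iota> c, \<iota> k, \<iota> c', \<iota> l, \<iota> c''}. \<Phi> v = (0, 0)"
      using coh coh_c kl cK by simp
    moreover have "\<Phi> (\<iota> (\<lambda>_. a)) = (1, 0)"
      unfolding \<iota>_def using coh by (intro \<Phi>_tower) (auto simp: \<phi>a)
    \<comment> \<open>At level \<open>i\<close> the partial product has image the sum over k < i,
      which agrees with the full series below degree \<open>i\<close>.\<close>
    moreover have "\<Phi> (\<iota> h) = (even_series B, 0)"
      unfolding \<iota>_def using coh by (intro \<Phi>_tower) (auto simp: h_def \<phi>pp trunc_def cutoff_even_series)
    ultimately show "\<exists>x y c k c' l w c''. relation_cycle L x y c k c' l w c'' \<in> cycles2 L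
      \<and> \<Phi> x = (1, 0) \<and> \<Phi> y = (even_series B, 0) \<and> (\<forall>v\<in>{c, k, c', l, c''}. \<Phi> v = (0, 0))"
      by blast
  qed
  then show ?thesis by (simp add: L_def)
qed

end
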